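(* Let $d\ge 1$, let $L\subset\mathbb{R}^d$ be a lattice with fundamental domain $\Omega$ and dual lattice $L^{\perp}$. Let $0\le\gamma_1,\dots,\gamma_d<1$ be real numbers. Suppose that for some $C>0$ the function $\sigma:L^{\perp}\to\mathbb{C}$ satisfies, for all $\kappa=(\kappa_1,\dots,\kappa_d)\in L^\perp$, $$|\sigma(\kappa)|\le C\langle\kappa_1\rangle^{-\gamma_1}\cdots\langle\kappa_d\rangle^{-\gamma_d},\qquad\langle\kappa_j\rangle:=(1+|\kappa_j|^2)^{1/2}.$$ Let $T$ be the Fourier multiplier with symbol $\sigma$, i.e. $\widehat{Tf}(\kappa)=\sigma(\kappa)\widehat f(\kappa)$ for all $\kappa\in L^{\perp}$. Then $$T:\mathrm{Lip}^{M}_{\Omega}(\alpha_1,\dots,\alpha_d;2)\to\mathrm{Lip}^{M}_{\Omega}(\alpha_1+\gamma_1,\dots,\alpha_d+\gamma_d;2)$$ is bounded (with respect to the norms defined in the context) for all $\alpha_1,\dots,\alpha_d\in\mathbb{R}$ with $0<\alpha_j<1-\gamma_j$ for all $1\le j\le d$.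
   Context: A lattice is $L=A\mathbb{Z}^d$ with $A$ an invertible real $d\times d$ matrix; its dual lattice is $L^{\perp}:=(A^{T})^{-1}\mathbb{Z}^d$. A fundamental domain of $L$ is a measurable set $\Omega\subseteq\mathbb{R}^d$ such that $\Omega+L=\mathbb{R}^d$ as a direct sum (every $x\in\mathbb{R}^d$ is uniquely $\omega+\ell$ with $\omega\in\Omega$, $\ell\in L$). $L^p(\Omega)$ is taken with respect to the normalised measure $\mathrm{d}x/|\Omega|$; functions on $\Omega$ are extended $L$-periodically to $\mathbb{R}^d$, which gives meaning to translates of $f$. The Fourier transform is $\widehat f(\kappa)=\frac{1}{|\Omega|}\int_{\Omega}f(x)e^{-2\pi i\kappa\cdot x}\,\mathrm{d}x$ for $\kappa\in L^{\perp}$. For $1\le j\le d$ and $h_j\in\mathbb{R}$, $\triangle_j^{h_j}f(x):=f(x+h_je_j)-f(x)$, with $e_j$ the $j$-th standard basis vector. For $0<\alpha_1,\dots,\alpha_d\le1$, $1<p\le\infty$, the multiplicative Hölder-Lipschitz space is $$\mathrm{Lip}^{M}_{\Omega}(\alpha_1,\dots,\alpha_d;p):=\{f\in L^p(\Omega):\|\triangle_1^{h_1}\cdots\triangle_d^{h_d}f\|_{L^p(\Omega)}=O(|h_1|^{\alpha_1}\cdots|h_d|^{\alpha_d})\text{ as }h\to0\},$$ where $O$ means: bounded by a positive constant times the right-hand side for all $h$ in a neighbourhood of $0$. For $0<\alpha_1,\dots,\alpha_d<1$ the space $\mathrm{Lip}^{M}_{\Omega}(\alpha_1,\dots,\alpha_d;2)$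 is endowed with the norm $$\|f\|_{\mathrm{Lip}^{M}_{\Omega}(\alpha_1,\dots,\alpha_d;2)}:=\|f\|_{L^2(\Omega)}+\sup_{N_1,\dots,N_d\in\mathbb{N}}N_1^{\alpha_1}\cdots N_d^{\alpha_d}\Big(\sum_{|\kappa_1|>N_1}\cdots\sum_{|\kappa_d|>N_d}|\widehat f(\kappa)|^2\Big)^{1/2},$$ where the sum is over $\kappa=(\kappa_1,\dots,\kappa_d)\in L^{\perp}$ with $|\kappa_j|>N_j$ for all $j$, and $0\in\mathbb{N}$. *)

theory Defs
  imports "HOL-Analysis.Analysis"
begin

definition lattice_of :: "real^'n^'n \<Rightarrow> (real^'n) set" where
  "lattice_of A = {A *v z | z. \<forall>i. z $ i \<in> \<int>}"

definition dual_lattice :: "real^'n^'n \<Rightarrow> (real^'n) set" where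
  "dual_lattice A = lattice_of (matrix_inv (transpose A))"

definition fundamental_domain :: "real^'n^'n \<Rightarrow> (real^'n) set \<Rightarrow> bool" where
  "fundamental_domain A \<Omega> \<longleftrightarrow>
     \<Omega> \<in> sets lebesgue \<and>
     (\<forall>x. \<exists>!p. p \<in> \<Omega> \<times> lattice_of A \<and> x = fst p + snd p)"

text \<open>
  A function on \<open>\<Omega>\<close> is represented by a function on the whole space of which only the values
  on \<open>\<Omega>\<close> matter: every notion below either integrates over \<open>\<Omega>\<close> or first passes to the
  periodic extension of the restriction to \<open>\<Omega>\<close>. Elements of \<open>L\<^sup>2(\<Omega>)\<close> are represented by
  functions, not by classes modulo null sets.
\<close>

definition periodic_ext ::
    "real^'n^'n \<Rightarrow> (real^'n) set \<Rightarrow> (real^'n \<Rightarrow> complex) \<Rightarrow> real^'n \<Rightarrow> complex" where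
  "periodic_ext A \<Omega> f x = f (THE \<omega>. \<omega> \<in> \<Omega> \<and> x - \<omega> \<in> lattice_of A)"

definition L2_space :: "(real^'n) set \<Rightarrow> (real^'n \<Rightarrow> complex) set" where
  "L2_space \<Omega> = {f. f \<in> borel_measurable (lebesgue_on \<Omega>) \<and>
                     integrable (lebesgue_on \<Omega>) (\<lambda>x. (norm (f x))\<^sup>2)}"

definition L2_norm_on :: "(real^'n) set \<Rightarrow> (real^'n \<Rightarrow> complex) \<Rightarrow> real" where
  "L2_norm_on \<Omega> f =
     sqrt (1 / measure lebesgue \<Omega> * (LINT x|lebesgue_on \<Omega>. (norm (f x))\<^sup>2))"

definition fourier_coeff ::
    "(real^'n) set \<Rightarrow> (real^'n \<Rightarrow> complex) \<Rightarrow> real^'n \<Rightarrow> complex" where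
  "fourier_coeff \<Omega> f \<kappa> =
     complex_of_real (1 / measure lebesgue \<Omega>) *
     (LINT x|lebesgue_on \<Omega>. f x * exp (- 2 * complex_of_real pi * \<i> * complex_of_real (\<kappa> \<bullet> x)))"

definition partial_diff :: "'n \<Rightarrow> real \<Rightarrow> (real^'n \<Rightarrow> complex) \<Rightarrow> real^'n \<Rightarrow> complex" where
  "partial_diff j t f x = f (x + t *\<^sub>R axis j 1) - f x"

text \<open>
  The composition of the operators \<^term>\<open>partial_diff j (h $ j)\<close> over all coordinates \<open>j\<close>.
  They commute, so \<^const>\<open>Finite_Set.fold\<close> is the composition in any order.
\<close>

definition mixed_diff :: "real^'n \<Rightarrow> (real^'n \<Rightarrow> complex) \<Rightarrow> real^'n \<Rightarrow> complex" where
  "mixed_diff h f = Finite_Set.fold (\<lambda>j. partial_diff j (h $ j)) f UNIV"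

lemma comp_fun_commute_partial_diff: "comp_fun_commute (\<lambda>j. partial_diff j (h $ j))"
  by standard (simp add: fun_eq_iff partial_diff_def add_ac)

text \<open>
  The multiplicative Hoelder-Lipschitz space with integrability exponent 2. If some \<open>h $ j\<close>
  vanishes, both sides of the estimate are 0, since \<open>0 powr a = 0\<close>.
\<close>

definition LipM :: "real^'n^'n \<Rightarrow> (real^'n) set \<Rightarrow> real^'n \<Rightarrow> (real^'n \<Rightarrow> complex) set" where
  "LipM A \<Omega> \<alpha> = {f \<in> L2_space \<Omega>. \<exists>K>0. \<forall>\<^sub>F h in nhds 0.
     L2_norm_on \<Omega> (mixed_diff h (periodic_ext A \<Omega> f)) \<le> K * (\<Prod>j\<in>UNIV. \<bar>h $ j\<bar> powr (\<alpha> $ j))}"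

definition fourier_tail ::
    "real^'n^'n \<Rightarrow> (real^'n) set \<Rightarrow> (real^'n \<Rightarrow> complex) \<Rightarrow> nat^'n \<Rightarrow> real" where
  "fourier_tail A \<Omega> f N =
     sqrt (\<Sum>\<^sub>\<infinity>\<kappa> \<in> {\<kappa> \<in> dual_lattice A. \<forall>j. \<bar>\<kappa> $ j\<bar> > real (N $ j)}. (norm (fourier_coeff \<Omega> f \<kappa>))\<^sup>2)"

text \<open>
  The norm takes values in \<^typ>\<open>ennreal\<close>, so that the supremum is the true one whether or not
  it is finite.
\<close>

definition LipM_norm ::
    "real^'n^'n \<Rightarrow> (real^'n) set \<Rightarrow> real^'n \<Rightarrow> (real^'n \<Rightarrow> complex) \<Rightarrow> ennreal" where
  "LipM_norm A \<Omega> \<alpha> f = ennreal (L2_norm_on \<Omega> f) +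
     (SUP N. ennreal ((\<Prod>j\<in>UNIV. real (N $ j) powr (\<alpha> $ j)) * fourier_tail A \<Omega> f N))"

definition fourier_multiplier ::
    "real^'n^'n \<Rightarrow> (real^'n) set \<Rightarrow> (real^'n \<Rightarrow> complex) \<Rightarrow>
     ((real^'n \<Rightarrow> complex) \<Rightarrow> real^'n \<Rightarrow> complex) \<Rightarrow> bool" where
  "fourier_multiplier A \<Omega> \<sigma> T \<longleftrightarrow>
     (\<forall>f \<in> L2_space \<Omega>. T f \<in> L2_space \<Omega> \<and>
        (\<forall>\<kappa> \<in> dual_lattice A. fourier_coeff \<Omega> (T f) \<kappa> = \<sigma> \<kappa> * fourier_coeff \<Omega> f \<kappa>))"

text \<open>
  Bounded linear operators between two of these spaces. Linearity is up to null sets, as the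
  elements are representatives. Finiteness of the source norm is demanded explicitly, so that
  the norm estimate cannot hold because its right-hand side is infinite.
\<close>

definition bounded_LipM_operator ::
    "real^'n^'n \<Rightarrow> (real^'n) set \<Rightarrow> real^'n \<Rightarrow> real^'n \<Rightarrow>
     ((real^'n \<Rightarrow> complex) \<Rightarrow> real^'n \<Rightarrow> complex) \<Rightarrow> bool" where
  "bounded_LipM_operator A \<Omega> \<alpha> \<beta> T \<longleftrightarrow>
     (\<forall>f \<in> LipM A \<Omega> \<alpha>. \<forall>g \<in> LipM A \<Omega> \<alpha>.
        AE x in lebesgue_on \<Omega>. T (\<lambda>y. f y + g y) x = T f x + T g x) \<and>
     (\<forall>f \<in> LipM A \<Omega> \<alpha>. \<forall>c. AE x in lebesgue_on \<Omega>. T (\<lambda>y. c * f y) x = c * T f x) \<and>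
     (\<forall>f \<in> LipM A \<Omega> \<alpha>. T f \<in> LipM A \<Omega> \<beta>) \<and>
     (\<forall>f \<in> LipM A \<Omega> \<alpha>. LipM_norm A \<Omega> \<alpha> f < top) \<and>
     (\<exists>M::real. \<forall>f \<in> LipM A \<Omega> \<alpha>. LipM_norm A \<Omega> \<beta> (T f) \<le> ennreal M * LipM_norm A \<Omega> \<alpha> f)"

definition japanese_bracket :: "real \<Rightarrow> real" where
  "japanese_bracket t = sqrt (1 + \<bar>t\<bar>\<^sup>2)"

end

theory Submission
  imports Defs
begin

text \<open>
  By Parseval on \<open>\<Omega>\<close>, the squared norm of the mixed difference of \<open>f\<close> with steps \<open>h\<^sub>j\<close> is the
  sum of \<open>|f^(\<kappa>)|\<^sup>2 \<Prod>\<^sub>j 4 sin\<^sup>2(\<pi> \<kappa>\<^sub>j h\<^sub>j)\<close> over the dual lattice. Both the cut-off to \<open>|u| > N\<close>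
  and the function \<open>4 sin\<^sup>2(\<pi> u H) \<langle>u\<rangle>\<^bsup>-2\<gamma>\<^esup>\<close> are dominated pointwise in \<open>u\<close> by one of the functions
  \<open>w\<^sub>i 4 sin\<^sup>2(\<pi> u \<delta> / 2\<^sup>i)\<close>, where \<open>\<Sum>\<^sub>i w\<^sub>i 2\<^bsup>-2i\<alpha>\<^esup>\<close> is of order \<open>N\<^bsup>-2\<alpha>\<^esup>\<close>, respectively
  \<open>H\<^bsup>2(\<alpha>+\<gamma>)\<^esup>\<close>. So the Lipschitz bound of \<open>f\<close> at dyadic steps gives both the decay of its Fourier
  tails and the Lipschitz bound of \<open>T f\<close>. The tails alone would not suffice for the latter: they
  see no frequency with some \<open>|\<kappa>\<^sub>j| \<le> 1\<close>, and such nonzero \<open>\<kappa>\<^sub>j\<close> exist in a general dual lattice.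
\<close>

section \<open>Unimodular orthonormal systems\<close>

text \<open>No single step would do: 4 sin^2(pi u h) vanishes whenever u h is an integer and is
  bounded below by a multiple of (u h)^2 only for small |u h|. Hence a frequency with |u| of size
  2^i is tested at a step of size \<delta> / 2^i, with a scale chosen independently in each
  coordinate, and \<delta> \<le> 1/8 keeps |u h| within 1/4. The comparison is made on finite sets
  of frequencies, where finitely many scales occur, and the constants do not depend on the set.
  Membership of T f in the target space and the norm estimate are separate matters. The norm
  consists of an L2 norm and Fourier tails, which the bound on the symbol controls directly, with
  operator bound C; the space is defined by differences, and these require the dyadic argument. The
  obstacle before all this is Parseval on a domain \<Omega> that is merely measurable and possibly
  unbounded: finite volume, translation invariance and completeness all have to be derived from
  unique decomposition modulo L. Completeness cannot use a topology on \<Omega>, so it is obtained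
  from Stone-Weierstrass on an embedded image of the quotient in C^n.\<close>

definition sq_integrable :: "'a measure \<Rightarrow> ('a \<Rightarrow> complex) set" where
  "sq_integrable M = {f \<in> borel_measurable M. integrable M (\<lambda>x. (norm (f x))\<^sup>2)}"

lemma sq_integrableD [measurable_dest]: "f \<in> sq_integrable M \<Longrightarrow> f \<in> borel_measurable M"
  by (simp add: sq_integrable_def)

lemma sq_integrable_integrable_norm2:
  "f \<in> sq_integrable M \<Longrightarrow> integrable M (\<lambda>x. (norm (f x))\<^sup>2)"
  by (simp add: sq_integrable_def)

lemma sq_integrable_add:
  assumes f: "f \<in> sq_integrable M" and g: "g \<in> sq_integrable M"
  shows "(\<lambda>x. f x + g x) \<in> sq_integrable M"
proof -
  have [measurable]: "f \<in> borel_measurable M" "g \<in> borel_measurable M"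
    using f g by (auto dest: sq_integrableD)
  have "integrable M (\<lambda>x. (norm (f x + g x))\<^sup>2)"
  proof (rule Bochner_Integration.integrable_bound)
    show "integrable M (\<lambda>x. 2 * (norm (f x))\<^sup>2 + 2 * (norm (g x))\<^sup>2)"
      using sq_integrable_integrable_norm2[OF f] sq_integrable_integrable_norm2[OF g] by simp
    show "AE x in M. norm ((norm (f x + g x))\<^sup>2) \<le> norm (2 * (norm (f x))\<^sup>2 + 2 * (norm (g x))\<^sup>2)"
    proof (rule AE_I2)
      fix x
      have "(norm (f x + g x))\<^sup>2 \<le> (norm (f x) + norm (g x))\<^sup>2"
        by (simp add: norm_triangle_ineq power_mono)
      also have "\<dots> \<le> 2 * (norm (f x))\<^sup>2 + 2 * (norm (g x))\<^sup>2"
        using sum_squares_bound[of "norm (f x)" "norm (g x)"] by (simp add: power2_sum)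
      finally show "norm ((norm (f x + g x))\<^sup>2) \<le> norm (2 * (norm (f x))\<^sup>2 + 2 * (norm (g x))\<^sup>2)"
        by simp
    qed
  qed measurable
  then show ?thesis
    by (simp add: sq_integrable_def)
qed

lemma sq_integrable_bounded_mult:
  assumes f: "f \<in> sq_integrable M" and g: "g \<in> borel_measurable M"
    and bd: "\<And>x. x \<in> space M \<Longrightarrow> norm (g x) \<le> B"
  shows "(\<lambda>x. g x * f x) \<in> sq_integrable M"
proof -
  note [measurable] = sq_integrableD[OF f] g
  have "integrable M (\<lambda>x. (norm (g x * f x))\<^sup>2)"
  proof (rule Bochner_Integration.integrable_bound)
    show "integrable M (\<lambda>x. B\<^sup>2 * (norm (f x))\<^sup>2)"
      using f by (auto intro: sq_integrable_integrable_norm2)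
    show "AE x in M. norm ((norm (g x * f x))\<^sup>2) \<le> norm (B\<^sup>2 * (norm (f x))\<^sup>2)"
      using bd by (intro AE_I2) (simp add: norm_mult power_mult_distrib mult_right_mono power_mono)
  qed measurable
  then show ?thesis
    by (simp add: sq_integrable_def)
qed

lemma sq_integrable_cmult: "f \<in> sq_integrable M \<Longrightarrow> (\<lambda>x. c * f x) \<in> sq_integrable M"
  by (rule sq_integrable_bounded_mult[where B = "norm c"]) auto

lemma sq_integrable_diff:
  "f \<in> sq_integrable M \<Longrightarrow> g \<in> sq_integrable M \<Longrightarrow> (\<lambda>x. f x - g x) \<in> sq_integrable M"
  using sq_integrable_add[of f M "\<lambda>x. (-1) * g x"] sq_integrable_cmult[of g M "-1"] by simp

lemma sq_integrable_zero: "(\<lambda>x. 0) \<in> sq_integrable M"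
  by (simp add: sq_integrable_def)

lemma sq_integrable_sum:
  "(\<And>i. i \<in> F \<Longrightarrow> f i \<in> sq_integrable M) \<Longrightarrow> (\<lambda>x. \<Sum>i\<in>F. f i x) \<in> sq_integrable M"
  by (induction F rule: infinite_finite_induct) (auto intro: sq_integrable_zero sq_integrable_add)

lemma (in finite_measure) sq_integrable_imp_integrable:
  assumes f: "f \<in> sq_integrable M"
  shows "integrable M f"
proof (rule Bochner_Integration.integrable_bound)
  show "integrable M (\<lambda>x. 1 + (norm (f x))\<^sup>2)"
    using f by (auto intro: sq_integrable_integrable_norm2)
  show "f \<in> borel_measurable M"
    using f by (rule sq_integrableD)
  show "AE x in M. norm (f x) \<le> norm (1 + (norm (f x))\<^sup>2)"
  proof (rule AE_I2)
    fix x
    have "0 \<le> (norm (f x) - 1)\<^sup>2"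
      by simp
    then have "2 * norm (f x) \<le> 1 + (norm (f x))\<^sup>2"
      by (simp add: power2_diff)
    then show "norm (f x) \<le> norm (1 + (norm (f x))\<^sup>2)"
      using norm_ge_zero[of "f x"] unfolding real_norm_def by linarith
  qed
qed

lemma measurable_cnj [measurable]: "cnj \<in> borel \<rightarrow>\<^sub>M borel"
  by (intro borel_measurable_continuous_onI continuous_intros)

text \<open>Abstracts the characters on \<Omega>. Modulus one over a finite measure makes
  \<open>f x * cnj (e k x)\<close> integrable for square integrable f and normalises
  \<open>coef (e k) k\<close> to 1. Completeness is split off into an extension, as its proof needs
  the geometry of the torus.\<close>

locale unimodular_system = finite_measure M for M :: "'a measure" +
  fixes e :: "'i \<Rightarrow> 'a \<Rightarrow> complex" and D :: "'i set"
  assumes measure_pos: "0 < measure M (space M)"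
    and countable_index: "countable D"
    and e_measurable [measurable]: "\<And>k. e k \<in> borel_measurable M"
    and norm_e: "\<And>k x. norm (e k x) = 1"
    and orthogonal: "\<And>k l. k \<in> D \<Longrightarrow> l \<in> D \<Longrightarrow> k \<noteq> l \<Longrightarrow> (LINT x|M. e k x * cnj (e l x)) = 0"
begin

definition coef :: "('a \<Rightarrow> complex) \<Rightarrow> 'i \<Rightarrow> complex" where
  "coef f k = complex_of_real (1 / measure M (space M)) * (LINT x|M. f x * cnj (e k x))"

definition energy :: "('a \<Rightarrow> complex) \<Rightarrow> real" where
  "energy f = 1 / measure M (space M) * (LINT x|M. (norm (f x))\<^sup>2)"

lemma integrable_times_char:
  "f \<in> sq_integrable M \<Longrightarrow> integrable M (\<lambda>x. f x * cnj (e k x))"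
  using sq_integrable_bounded_mult[of f M "\<lambda>x. cnj (e k x)" 1]
  by (auto simp: mult.commute norm_e intro!: sq_integrable_imp_integrable)

lemma coef_add:
  "f \<in> sq_integrable M \<Longrightarrow> g \<in> sq_integrable M \<Longrightarrow> coef (\<lambda>x. f x + g x) k = coef f k + coef g k"
  by (simp add: coef_def distrib_right integrable_times_char distrib_left)

lemma coef_diff:
  "f \<in> sq_integrable M \<Longrightarrow> g \<in> sq_integrable M \<Longrightarrow> coef (\<lambda>x. f x - g x) k = coef f k - coef g k"
  by (simp add: coef_def left_diff_distrib integrable_times_char right_diff_distrib diff_divide_distrib)

lemma coef_cmult: "coef (\<lambda>x. c * f x) k = c * coef f k"
  by (simp add: coef_def mult.assoc)

lemma e_sq_integrable: "e k \<in> sq_integrable M"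
  by (simp add: sq_integrable_def norm_e)

lemma poly_sq_integrable: "(\<lambda>x. \<Sum>k\<in>F. c k * e k x) \<in> sq_integrable M"
  by (intro sq_integrable_sum sq_integrable_cmult e_sq_integrable)

lemma coef_e: "k \<in> D \<Longrightarrow> l \<in> D \<Longrightarrow> coef (e k) l = (if k = l then 1 else 0)"
  using measure_pos orthogonal[of k l] by (auto simp: coef_def norm_e complex_norm_square[symmetric] scaleR_conv_of_real)

lemma coef_sum:
  "(\<And>i. i \<in> F \<Longrightarrow> f i \<in> sq_integrable M) \<Longrightarrow> coef (\<lambda>x. \<Sum>i\<in>F. f i x) k = (\<Sum>i\<in>F. coef (f i) k)"
proof (induction F rule: infinite_finite_induct)
  case (insert i F)
  then show ?case
    by (simp add: coef_add sq_integrable_sum)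
qed (simp_all add: coef_def)

lemma coef_poly:
  assumes "finite F" "F \<subseteq> D" "l \<in> D"
  shows "coef (\<lambda>x. \<Sum>k\<in>F. c k * e k x) l = (if l \<in> F then c l else 0)"
proof -
  have "coef (\<lambda>x. \<Sum>k\<in>F. c k * e k x) l = (\<Sum>k\<in>F. c k * (if k = l then 1 else 0))"
    using assms
    by (subst coef_sum) (auto simp: coef_cmult coef_e e_sq_integrable intro!: sq_integrable_cmult sum.cong)
  then show ?thesis
    using assms by (simp add: if_distrib cong: if_cong)
qed

lemma integral_times_poly:
  assumes f: "f \<in> sq_integrable M" and F: "finite F"
  shows "(LINT x|M. f x * cnj (\<Sum>k\<in>F. c k * e k x)) =
    complex_of_real (measure M (space M)) * (\<Sum>k\<in>F. cnj (c k) * coef f k)"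
proof -
  have "(LINT x|M. f x * cnj (\<Sum>k\<in>F. c k * e k x)) = (LINT x|M. (\<Sum>k\<in>F. cnj (c k) * (f x * cnj (e k x))))"
    by (simp add: sum_distrib_left mult_ac)
  also have "\<dots> = (\<Sum>k\<in>F. cnj (c k) * (LINT x|M. f x * cnj (e k x)))"
    using integrable_times_char[OF f] by (subst Bochner_Integration.integral_sum) auto
  also have "\<dots> = complex_of_real (measure M (space M)) * (\<Sum>k\<in>F. cnj (c k) * coef f k)"
    using measure_pos by (simp add: coef_def sum_distrib_left)
  finally show ?thesis .
qed

lemma integrable_mult_cnj:
  assumes f: "f \<in> sq_integrable M" and g: "g \<in> sq_integrable M"
  shows "integrable M (\<lambda>x. f x * cnj (g x))"
proof (rule Bochner_Integration.integrable_bound)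
  note [measurable] = sq_integrableD[OF f] sq_integrableD[OF g]
  show "integrable M (\<lambda>x. (norm (f x))\<^sup>2 + (norm (g x))\<^sup>2)"
    using f g by (auto intro: sq_integrable_integrable_norm2)
  show "(\<lambda>x. f x * cnj (g x)) \<in> borel_measurable M"
    by measurable
  show "AE x in M. norm (f x * cnj (g x)) \<le> norm ((norm (f x))\<^sup>2 + (norm (g x))\<^sup>2)"
  proof (rule AE_I2)
    fix x
    have "2 * (norm (f x) * norm (g x)) \<le> (norm (f x))\<^sup>2 + (norm (g x))\<^sup>2"
      using sum_squares_bound[of "norm (f x)" "norm (g x)"] by simp
    then show "norm (f x * cnj (g x)) \<le> norm ((norm (f x))\<^sup>2 + (norm (g x))\<^sup>2)"
      using mult_nonneg_nonneg[OF norm_ge_zero[of "f x"] norm_ge_zero[of "g x"]]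
      unfolding real_norm_def norm_mult complex_mod_cnj by linarith
  qed
qed

text \<open>Common source of two facts: \<open>c = coef f\<close> gives Bessel's inequality, and f =
  0 gives the energy of a polynomial.\<close>

lemma energy_diff_poly:
  assumes f: "f \<in> sq_integrable M" and F: "finite F" "F \<subseteq> D"
  shows "energy (\<lambda>x. f x - (\<Sum>k\<in>F. c k * e k x)) =
    energy f - 2 * Re (\<Sum>k\<in>F. cnj (c k) * coef f k) + (\<Sum>k\<in>F. (norm (c k))\<^sup>2)"
proof -
  define P where "P = (\<lambda>x. \<Sum>k\<in>F. c k * e k x)"
  let ?m = "measure M (space M)"
  have P: "P \<in> sq_integrable M"
    unfolding P_def by (rule poly_sq_integrable)
  have fP: "integrable M (\<lambda>x. f x * cnj (P x))" and PP: "integrable M (\<lambda>x. P x * cnj (P x))"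
    using f P by (auto intro: integrable_mult_cnj)
  have "(norm (f x - P x))\<^sup>2 = (norm (f x))\<^sup>2 - 2 * Re (f x * cnj (P x)) + Re (P x * cnj (P x))" for x
    unfolding cmod_power2 by (simp add: power2_eq_square algebra_simps)
  moreover have "(LINT x|M. (norm (f x))\<^sup>2 - 2 * Re (f x * cnj (P x)) + Re (P x * cnj (P x))) =
      (LINT x|M. (norm (f x))\<^sup>2) - 2 * Re (LINT x|M. f x * cnj (P x)) + Re (LINT x|M. P x * cnj (P x))"
    using fP PP f
    by (simp add: sq_integrable_integrable_norm2 del: times_complex.sel)
  ultimately have "(LINT x|M. (norm (f x - P x))\<^sup>2) =
      (LINT x|M. (norm (f x))\<^sup>2) - 2 * Re (LINT x|M. f x * cnj (P x)) + Re (LINT x|M. P x * cnj (P x))"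
    by simp
  also have "(LINT x|M. f x * cnj (P x)) = complex_of_real ?m * (\<Sum>k\<in>F. cnj (c k) * coef f k)"
    unfolding P_def using f F by (intro integral_times_poly)
  also have "(LINT x|M. P x * cnj (P x)) = complex_of_real ?m * (\<Sum>k\<in>F. cnj (c k) * coef P k)"
    using integral_times_poly[OF P F(1), of c] by (simp add: P_def)
  also have "(\<Sum>k\<in>F. cnj (c k) * coef P k) = (\<Sum>k\<in>F. complex_of_real ((norm (c k))\<^sup>2))"
    using F coef_poly[OF F, of _ c]
    by (intro sum.cong) (auto simp: P_def subset_iff complex_norm_square[symmetric] mult.commute)
  finally show ?thesis
    using measure_pos by (simp add: energy_def P_def field_simps del: of_real_power flip: of_real_sum)
qed

lemma bessel:
  assumes f: "f \<in> sq_integrable M" and F: "finite F" "F \<subseteq> D"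
  shows "(\<Sum>k\<in>F. (norm (coef f k))\<^sup>2) \<le> energy f"
proof -
  have "(\<Sum>k\<in>F. cnj (coef f k) * coef f k) = complex_of_real (\<Sum>k\<in>F. (norm (coef f k))\<^sup>2)"
    by (simp add: complex_norm_square mult.commute del: of_real_power)
  then have "Re (\<Sum>k\<in>F. cnj (coef f k) * coef f k) = (\<Sum>k\<in>F. (norm (coef f k))\<^sup>2)"
    by simp
  moreover have "0 \<le> energy (\<lambda>x. f x - (\<Sum>k\<in>F. coef f k * e k x))"
    by (simp add: energy_def)
  ultimately show ?thesis
    using energy_diff_poly[OF f F, of "coef f"] by linarith
qed

lemma energy_poly:
  assumes F: "finite F" "F \<subseteq> D"
  shows "energy (\<lambda>x. \<Sum>k\<in>F. c k * e k x) = (\<Sum>k\<in>F. (norm (c k))\<^sup>2)"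
  using energy_diff_poly[OF sq_integrable_zero F, of c] by (simp add: energy_def coef_def)

lemma summable_coef:
  assumes "f \<in> sq_integrable M"
  shows "(\<lambda>k. (norm (coef f k))\<^sup>2) summable_on D"
  using bessel[OF assms]
  by (intro nonneg_bounded_partial_sums_imp_summable_on[where C = "energy f"] eventually_finite_subsets_at_top_weakI) auto

text \<open>
  The partial sums are Cauchy in \<open>L\<^sup>1\<close>, hence a subsequence converges almost everywhere; Fatou's
  lemma bounds the energy of the limit minus any partial sum by the remaining tail of the series.
\<close>

lemma riesz_fischer:
  assumes c: "(\<lambda>k. (norm (c k))\<^sup>2) summable_on D"
  obtains g where "g \<in> sq_integrable M" "\<And>k. k \<in> D \<Longrightarrow> coef g k = c k"
    "energy g \<le> (\<Sum>\<^sub>\<infinity>k\<in>D. (norm (c k))\<^sup>2)"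
proof -
  let ?m = "measure M (space M)"
  \<comment> \<open>Finite sets exhausting D along the enumeration \<open>to_nat_on D\<close>. The
    strict inequality makes \<open>Dn 0\<close> empty, so that \<open>S 0\<close> is the zero
    function.\<close>
  define Dn where "Dn n = {k \<in> D. to_nat_on D k < n}" for n
  have fin: "finite (Dn n)" for n
  proof (rule inj_on_finite[of "to_nat_on D" _ "{..<n}"])
    show "inj_on (to_nat_on D) (Dn n)"
      using inj_on_to_nat_on[OF countable_index] by (rule inj_on_subset) (auto simp: Dn_def)
  qed (auto simp: Dn_def)
  have sub: "Dn n \<subseteq> D" and mono: "n \<le> n' \<Longrightarrow> Dn n \<subseteq> Dn n'" for n n'
    by (auto simp: Dn_def)
  define S where "S n x = (\<Sum>k\<in>Dn n. c k * e k x)" for n x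
  define a where "a n = (\<Sum>k\<in>Dn n. (norm (c k))\<^sup>2)" for n
  define A where "A = (\<Sum>\<^sub>\<infinity>k\<in>D. (norm (c k))\<^sup>2)"
  have S: "S n \<in> sq_integrable M" for n
    unfolding S_def[abs_def] by (rule poly_sq_integrable)
  note [measurable] = sq_integrableD[OF S]
  have a_le: "a n \<le> A" for n
    unfolding a_def A_def using fin sub by (intro finite_sum_le_infsum c) auto
  have a_lim: "a \<longlonglongrightarrow> A"
  proof -
    have "(sum (\<lambda>k. (norm (c k))\<^sup>2) \<longlongrightarrow> A) (finite_subsets_at_top D)"
      using c unfolding A_def by (rule infsum_tendsto)
    moreover have "filterlim Dn (finite_subsets_at_top D) sequentially"
    proof (rule filterlim_finite_subsets_at_top[THEN iffD2], intro allI impI)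
      fix X assume X: "finite X \<and> X \<subseteq> D"
      show "\<forall>\<^sub>F y in sequentially. finite (Dn y) \<and> X \<subseteq> Dn y \<and> Dn y \<subseteq> D"
        using eventually_gt_at_top[of "Max (to_nat_on D ` X)"]
      proof eventually_elim
        case (elim y)
        have "to_nat_on D k < y" if "k \<in> X" for k
          using Max_ge[of "to_nat_on D ` X" "to_nat_on D k"] X that elim by (meson finite_imageI imageI le_less_trans)
        then have "X \<subseteq> Dn y"
          using X by (auto simp: Dn_def)
        then show ?case
          using fin sub by blast
      qed
    qed
    ultimately show ?thesis
      unfolding a_def[abs_def] by (rule filterlim_compose)
  qed
  have a_inc: "n \<le> n' \<Longrightarrow> a n \<le> a n'" for n n'
    unfolding a_def by (intro sum_mono2 fin mono) auto
  have en_le: "energy (\<lambda>x. S i x - S j x) = a i - a j" if "j \<le> i" for i j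
  proof -
    have 1: "S i x - S j x = (\<Sum>k\<in>Dn i - Dn j. c k * e k x)" for x
      unfolding S_def by (rule sum_diff[OF fin mono[OF that], symmetric])
    have "energy (\<lambda>x. S i x - S j x) = (\<Sum>k\<in>Dn i - Dn j. (norm (c k))\<^sup>2)"
      unfolding 1 using fin sub by (intro energy_poly) auto
    also have "\<dots> = a i - a j"
      unfolding a_def by (rule sum_diff[OF fin mono[OF that]])
    finally show ?thesis .
  qed
  have en: "energy (\<lambda>x. S i x - S j x) = \<bar>a i - a j\<bar>" for i j
  proof (cases "j \<le> i")
    case False
    then have "energy (\<lambda>x. S j x - S i x) = a j - a i"
      by (intro en_le) simp
    moreover have "energy (\<lambda>x. S j x - S i x) = energy (\<lambda>x. S i x - S j x)"
      by (simp add: energy_def norm_minus_commute)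
    ultimately show ?thesis
      using a_inc[of i j] False by simp
  qed (use en_le a_inc[of j i] in simp)
  \<comment> \<open>Stands in for Cauchy-Schwarz: the weighted inequality between arithmetic and
    geometric mean bounds the L1 norm by the energy, with a free parameter.\<close>
  have L1: "(LINT x|M. norm (S i x - S j x)) \<le> \<delta> * ?m / 2 + ?m * \<bar>a i - a j\<bar> / (2 * \<delta>)"
    if "\<delta> > 0" for i j \<delta>
  proof -
    have sq: "(\<lambda>x. S i x - S j x) \<in> sq_integrable M"
      by (intro sq_integrable_diff S)
    have "(LINT x|M. norm (S i x - S j x)) \<le> (LINT x|M. \<delta> / 2 + (norm (S i x - S j x))\<^sup>2 / (2 * \<delta>))"
    proof (rule integral_mono)
      show "integrable M (\<lambda>x. norm (S i x - S j x))"
        using sq by (intro integrable_norm sq_integrable_imp_integrable)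
      show "integrable M (\<lambda>x. \<delta> / 2 + (norm (S i x - S j x))\<^sup>2 / (2 * \<delta>))"
        using sq_integrable_integrable_norm2[OF sq] by simp
      fix x
      have "0 \<le> (norm (S i x - S j x) - \<delta>)\<^sup>2 / (2 * \<delta>)"
        using that by simp
      also have "\<dots> = \<delta> / 2 + (norm (S i x - S j x))\<^sup>2 / (2 * \<delta>) - norm (S i x - S j x)"
        using that by (simp add: power2_diff field_simps power2_eq_square)
      finally show "norm (S i x - S j x) \<le> \<delta> / 2 + (norm (S i x - S j x))\<^sup>2 / (2 * \<delta>)"
        by simp
    qed
    also have "\<dots> = \<delta> * ?m / 2 + ?m * energy (\<lambda>x. S i x - S j x) / (2 * \<delta>)"
      using sq measure_pos sq_integrable_integrable_norm2[OF sq] by (simp add: energy_def)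
    finally show ?thesis
      by (simp add: en)
  qed
  have "\<exists>N. \<forall>i\<ge>N. \<forall>j\<ge>N. (LINT x|M. norm (S i x - S j x)) < \<epsilon>" if "\<epsilon> > 0" for \<epsilon>
  proof -
    \<comment> \<open>Once \<open>\<bar>a i - a j\<bar> < \<delta>\<^sup>2\<close>, this value makes
      each of the two summands in \<open>L1\<close> contribute at most \<epsilon> / 2.\<close>
    define \<delta> where "\<delta> = \<epsilon> / ?m"
    have \<delta>: "\<delta> > 0"
      using that measure_pos by (simp add: \<delta>_def)
    have "Cauchy a"
      using a_lim by (rule LIMSEQ_imp_Cauchy)
    then obtain N where N: "\<And>i j. i \<ge> N \<Longrightarrow> j \<ge> N \<Longrightarrow> \<bar>a i - a j\<bar> < \<delta>\<^sup>2"
      using \<delta> unfolding Cauchy_def dist_real_def by (meson zero_less_power)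
    have "(LINT x|M. norm (S i x - S j x)) < \<epsilon>" if "i \<ge> N" "j \<ge> N" for i j
    proof -
      have "(LINT x|M. norm (S i x - S j x)) \<le> \<delta> * ?m / 2 + ?m * \<bar>a i - a j\<bar> / (2 * \<delta>)"
        using \<delta> by (rule L1)
      also have "\<dots> < \<delta> * ?m / 2 + ?m * \<delta>\<^sup>2 / (2 * \<delta>)"
        using N[OF that] \<delta> measure_pos by (intro add_strict_left_mono divide_strict_right_mono mult_strict_left_mono) auto
      also have "\<dots> = \<epsilon>"
        using \<delta> measure_pos by (simp add: \<delta>_def power2_eq_square field_simps)
      finally show ?thesis .
    qed
    then show ?thesis
      by blast
  qed
  then obtain r where r: "strict_mono r" "AE x in M. Cauchy (\<lambda>i. S (r i) x)"
    using cauchy_L1_AE_cauchy_subseq[of M S] sq_integrable_imp_integrable[OF S] by blast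
  define g where "g x = lim (\<lambda>i. S (r i) x)" for x
  have [measurable]: "g \<in> borel_measurable M"
    unfolding g_def[abs_def] by (intro borel_measurable_lim_metric) measurable
  have g_lim: "AE x in M. (\<lambda>i. S (r i) x) \<longlonglongrightarrow> g x"
    using r(2) by eventually_elim (simp add: g_def Cauchy_convergent_iff convergent_LIMSEQ_iff)
  have fatou: "integrable M (\<lambda>x. (norm (g x - S n x))\<^sup>2) \<and> energy (\<lambda>x. g x - S n x) \<le> A - a n" for n
  proof -
    have lim2: "AE x in M. ennreal ((norm (g x - S n x))\<^sup>2) =
        liminf (\<lambda>i. ennreal ((norm (S (r i) x - S n x))\<^sup>2))"
      using g_lim
    proof eventually_elim
      case (elim x)
      have "(\<lambda>i. ennreal ((norm (S (r i) x - S n x))\<^sup>2)) \<longlonglongrightarrow> ennreal ((norm (g x - S n x))\<^sup>2)"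
        by (intro tendsto_ennrealI tendsto_intros elim)
      then show ?case
        by (rule lim_imp_Liminf[OF trivial_limit_sequentially, symmetric])
    qed
    have "(\<integral>\<^sup>+x. ennreal ((norm (g x - S n x))\<^sup>2) \<partial>M) =
        (\<integral>\<^sup>+x. liminf (\<lambda>i. ennreal ((norm (S (r i) x - S n x))\<^sup>2)) \<partial>M)"
      using lim2 by (rule nn_integral_cong_AE)
    also have "\<dots> \<le> liminf (\<lambda>i. \<integral>\<^sup>+x. ennreal ((norm (S (r i) x - S n x))\<^sup>2) \<partial>M)"
      by (rule nn_integral_liminf) measurable
    also have "\<dots> \<le> liminf (\<lambda>i. ennreal (?m * (A - a n)))"
    proof (rule Liminf_mono)
      show "\<forall>\<^sub>F i in sequentially. (\<integral>\<^sup>+x. ennreal ((norm (S (r i) x - S n x))\<^sup>2) \<partial>M) \<le> ennreal (?m * (A - a n))"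
        using eventually_ge_at_top[of n]
      proof eventually_elim
        case (elim i)
        have "n \<le> r i"
          using elim seq_suble[OF r(1), of i] by simp
        have sq: "(\<lambda>x. S (r i) x - S n x) \<in> sq_integrable M"
          by (intro sq_integrable_diff S)
        have "(\<integral>\<^sup>+x. ennreal ((norm (S (r i) x - S n x))\<^sup>2) \<partial>M) =
            ennreal (LINT x|M. (norm (S (r i) x - S n x))\<^sup>2)"
          using sq_integrable_integrable_norm2[OF sq] by (intro nn_integral_eq_integral) auto
        also have "(LINT x|M. (norm (S (r i) x - S n x))\<^sup>2) = ?m * energy (\<lambda>x. S (r i) x - S n x)"
          using measure_pos by (simp add: energy_def)
        also have "\<dots> = ?m * (a (r i) - a n)"
          using \<open>n \<le> r i\<close> by (simp add: en_le)
        also have "ennreal \<dots> \<le> ennreal (?m * (A - a n))"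
          using a_le[of "r i"] by (intro ennreal_leI mult_left_mono) auto
        finally show ?case .
      qed
    qed
    also have "\<dots> = ennreal (?m * (A - a n))"
      by (simp add: Liminf_const)
    finally have le: "(\<integral>\<^sup>+x. ennreal ((norm (g x - S n x))\<^sup>2) \<partial>M) \<le> ennreal (?m * (A - a n))" .
    have int: "integrable M (\<lambda>x. (norm (g x - S n x))\<^sup>2)"
      using le by (intro integrableI_nonneg) (auto intro: le_less_trans)
    have "ennreal (LINT x|M. (norm (g x - S n x))\<^sup>2) \<le> ennreal (?m * (A - a n))"
      using le nn_integral_eq_integral[OF int] by simp
    then have "(LINT x|M. (norm (g x - S n x))\<^sup>2) \<le> ?m * (A - a n)"
      using a_le[of n] by (subst (asm) ennreal_le_iff) auto
    then show ?thesis
      using int measure_pos by (simp add: energy_def field_simps)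
  qed
  \<comment> \<open>Against the empty partial sum, \<open>fatou\<close> yields both the square
    integrability of g and its energy bound.\<close>
  have S0: "S 0 x = 0" "a 0 = 0" for x
    by (simp_all add: S_def a_def Dn_def)
  have g: "g \<in> sq_integrable M"
    using fatou[of 0] by (simp add: sq_integrable_def S0)
  have "coef g k = c k" if k: "k \<in> D" for k
  proof -
    have "\<forall>\<^sub>F n in sequentially. (norm (coef g k - c k))\<^sup>2 \<le> A - a n"
      using eventually_gt_at_top[of "to_nat_on D k"]
    proof eventually_elim
      case (elim n)
      have "coef (S n) k = c k"
        unfolding S_def[abs_def] using elim k by (subst coef_poly[OF fin sub k]) (simp add: Dn_def)
      \<comment> \<open>Bessel for the single index k turns the energy of the remainder into a bound
        on one coefficient.\<close>
      then have "(norm (coef g k - c k))\<^sup>2 = (\<Sum>k\<in>{k}. (norm (coef (\<lambda>x. g x - S n x) k))\<^sup>2)"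
        by (simp add: coef_diff g S)
      also have "\<dots> \<le> energy (\<lambda>x. g x - S n x)"
        using k by (intro bessel sq_integrable_diff g S) auto
      also have "\<dots> \<le> A - a n"
        using fatou by blast
      finally show ?case .
    qed
    moreover have "(\<lambda>n. A - a n) \<longlonglongrightarrow> A - A"
      by (intro tendsto_intros a_lim)
    ultimately have "(norm (coef g k - c k))\<^sup>2 \<le> A - A"
      by (intro tendsto_lowerbound[of "\<lambda>n. A - a n" _ sequentially]) auto
    then show ?thesis
      by simp
  qed
  moreover have "energy g \<le> A"
    using fatou[of 0] by (simp add: S0)
  ultimately show thesis
    using that g unfolding A_def by blast
qed

end

locale complete_unimodular_system = unimodular_system +
  assumes total: "\<And>f. f \<in> sq_integrable M \<Longrightarrow> (\<And>k. k \<in> D \<Longrightarrow> coef f k = 0) \<Longrightarrow> AE x in M. f x = 0"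
begin

lemma coef_unique:
  assumes "f \<in> sq_integrable M" "g \<in> sq_integrable M" "\<And>k. k \<in> D \<Longrightarrow> coef f k = coef g k"
  shows "AE x in M. f x = g x"
  using total[OF sq_integrable_diff[OF assms(1,2)]] assms by (simp add: coef_diff)

text \<open>Riesz-Fischer produces a g with the coefficients of f and energy at most their square
  sum; completeness identifies g with f almost everywhere. The other inequality is Bessel's.\<close>

lemma parseval:
  assumes f: "f \<in> sq_integrable M"
  shows "energy f = (\<Sum>\<^sub>\<infinity>k\<in>D. (norm (coef f k))\<^sup>2)"
proof (rule antisym)
  obtain g where g: "g \<in> sq_integrable M" "\<And>k. k \<in> D \<Longrightarrow> coef g k = coef f k"
    "energy g \<le> (\<Sum>\<^sub>\<infinity>k\<in>D. (norm (coef f k))\<^sup>2)"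
    using riesz_fischer[OF summable_coef[OF f]] by blast
  have "AE x in M. f x = g x"
    using f g by (intro coef_unique) auto
  then have "energy f = energy g"
    unfolding energy_def using f g(1)
    by (intro arg_cong2[where f = "(*)"] refl integral_cong_AE) (auto dest: sq_integrableD)
  then show "energy f \<le> (\<Sum>\<^sub>\<infinity>k\<in>D. (norm (coef f k))\<^sup>2)"
    using g(3) by simp
  show "(\<Sum>\<^sub>\<infinity>k\<in>D. (norm (coef f k))\<^sup>2) \<le> energy f"
    using bessel[OF f] by (intro infsum_le_finite_sums summable_coef[OF f]) auto
qed

end

section \<open>Fundamental domains and characters\<close>

lemma emeasure_lebesgue_translation:
  fixes S :: "'a::euclidean_space set"
  shows "emeasure lebesgue ((+) a ` S) = emeasure lebesgue S"
  using emeasure_lebesgue_affine[of 1 a S] by (simp add: add.commute)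

lemma lattice_of_zero: "0 \<in> lattice_of A"
  unfolding lattice_of_def by (rule CollectI, rule exI[of _ 0]) simp

lemma lattice_of_add: "x \<in> lattice_of A \<Longrightarrow> y \<in> lattice_of A \<Longrightarrow> x + y \<in> lattice_of A"
  unfolding lattice_of_def
  by clarify (metis (no_types, lifting) Ints_add matrix_vector_right_distrib vector_add_component)

lemma lattice_of_minus: "x \<in> lattice_of A \<Longrightarrow> - x \<in> lattice_of A"
proof -
  assume "x \<in> lattice_of A"
  then obtain z where "x = A *v z" "\<forall>i. z $ i \<in> \<int>"
    by (auto simp: lattice_of_def)
  then have "- x = A *v (- z) \<and> (\<forall>i. (- z) $ i \<in> \<int>)"
    by (simp add: vec.neg)
  then show ?thesis
    unfolding lattice_of_def by blast
qed

lemma lattice_of_diff: "x \<in> lattice_of A \<Longrightarrow> y \<in> lattice_of A \<Longrightarrow> x - y \<in> lattice_of A"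
  using lattice_of_add[of x A "- y"] lattice_of_minus[of y A] by simp

lemma countable_lattice_of: "countable (lattice_of (A :: real^'n^'n))"
proof (rule countable_subset)
  show "lattice_of A \<subseteq> range (\<lambda>f :: 'n \<Rightarrow> int. A *v (\<chi> i. of_int (f i)))"
  proof
    fix x assume "x \<in> lattice_of A"
    then obtain z where z: "x = A *v z" "\<And>i. z $ i \<in> \<int>"
      by (auto simp: lattice_of_def)
    have "x = A *v (\<chi> i. of_int ((\<lambda>i. \<lfloor>z $ i\<rfloor>) i))"
      using z by (simp add: vec_eq_iff)
    then show "x \<in> range (\<lambda>f :: 'n \<Rightarrow> int. A *v (\<chi> i. of_int (f i)))"
      by (intro image_eqI[where x = "\<lambda>i. \<lfloor>z $ i\<rfloor>"]) simp_all
  qed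
qed simp

lemma matrix_inv_left: "invertible A \<Longrightarrow> matrix_inv A ** A = mat 1"
  and matrix_inv_right: "invertible A \<Longrightarrow> A ** matrix_inv A = mat 1"
  for A :: "real^'n^'n"
  unfolding invertible_def matrix_inv_def by (metis (mono_tags, lifting) someI_ex)+

section \<open>Characters and their pairing with the lattice\<close>

definition character :: "real^'n \<Rightarrow> real^'n \<Rightarrow> complex" where
  "character \<kappa> x = cis (2 * pi * (\<kappa> \<bullet> x))"

lemma norm_character [simp]: "norm (character \<kappa> x) = 1"
  by (simp add: character_def)

lemma continuous_on_character [continuous_intros]: "continuous_on S (character \<kappa>)"
  unfolding character_def[abs_def] by (intro continuous_intros)

lemma character_measurable [measurable]: "character \<kappa> \<in> borel_measurable borel"
  by (intro borel_measurable_continuous_onI continuous_intros)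

lemma character_lebesgue_on [measurable]: "character \<kappa> \<in> borel_measurable (lebesgue_on S)"
  using character_measurable measurable_completion measurable_restrict_space1 by (metis measurable_lborel2)

lemma character_add: "character \<kappa> (x + y) = character \<kappa> x * character \<kappa> y"
  by (simp add: character_def inner_add_right distrib_left cis_mult)

lemma character_add_index: "character (\<kappa> + \<kappa>') x = character \<kappa> x * character \<kappa>' x"
  by (simp add: character_def inner_add_left distrib_left cis_mult)

lemma character_minus_index: "character (- \<kappa>) x = cnj (character \<kappa> x)"
  by (simp add: character_def cis_cnj)

lemma character_zero [simp]: "character 0 x = 1"
  by (simp add: character_def)

lemma character_eq_1_iff: "character \<kappa> x = 1 \<longleftrightarrow> \<kappa> \<bullet> x \<in> \<int>"
proof
  assume "character \<kappa> x = 1"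
  then have "cos (2 * pi * (\<kappa> \<bullet> x)) = 1"
    by (simp add: character_def complex_eq_iff)
  then obtain n :: int where "2 * pi * (\<kappa> \<bullet> x) = of_int n * 2 * pi"
    unfolding cos_one_2pi_int by blast
  then have "\<kappa> \<bullet> x = of_int n"
    by simp
  then show "\<kappa> \<bullet> x \<in> \<int>"
    by simp
next
  assume "\<kappa> \<bullet> x \<in> \<int>"
  then obtain n :: int where "\<kappa> \<bullet> x = of_int n"
    by (elim Ints_cases)
  then show "character \<kappa> x = 1"
    by (simp add: character_def cis_multiple_2pi)
qed

lemma dual_lattice_inner:
  fixes A :: "real^'n^'n"
  assumes "invertible A"
  shows "(matrix_inv (transpose A) *v m) \<bullet> (A *v z) = m \<bullet> z"
proof -
  have inv: "invertible (transpose A)"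
    using assms by (rule transpose_invertible)
  have "(matrix_inv (transpose A) *v m) \<bullet> (A *v z) = (transpose A *v (matrix_inv (transpose A) *v m)) \<bullet> z"
    by (metis dot_lmul_matrix transpose_matrix_vector)
  then show ?thesis
    by (simp add: matrix_vector_mul_assoc matrix_inv_right[OF inv])
qed

lemma dual_lattice_inner_Ints:
  assumes "invertible A" "\<kappa> \<in> dual_lattice A" "l \<in> lattice_of A"
  shows "\<kappa> \<bullet> l \<in> \<int>"
proof -
  obtain m z where "\<kappa> = matrix_inv (transpose A) *v m" "l = A *v z" "\<And>i. m $ i \<in> \<int>" "\<And>i. z $ i \<in> \<int>"
    using assms(2,3) unfolding dual_lattice_def lattice_of_def by blast
  then show ?thesis
    using dual_lattice_inner[OF assms(1), of m z] by (simp add: inner_vec_def Ints_sum)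
qed

section \<open>Reduction modulo the lattice, translation invariance and volume of the domain\<close>

locale lattice_domain =
  fixes A :: "real^'n^'n" and \<Omega> :: "(real^'n) set"
  assumes invertible_A: "invertible A" and fundamental: "fundamental_domain A \<Omega>"
begin

abbreviation "L \<equiv> lattice_of A"

text \<open>The quotient map by L, realised with values in \<Omega>.
  \<open>periodic_ext A \<Omega> f\<close> is f composed with it, and sending x to
  \<open>rep (x + t)\<close> is translation by t on the quotient.\<close>

definition rep :: "real^'n \<Rightarrow> real^'n" where
  "rep x = (THE \<omega>. \<omega> \<in> \<Omega> \<and> x - \<omega> \<in> L)"

lemma Omega_sets [measurable]: "\<Omega> \<in> sets lebesgue"
  using fundamental by (simp add: fundamental_domain_def)

lemma unique_rep: "\<exists>!\<omega>. \<omega> \<in> \<Omega> \<and> x - \<omega> \<in> L"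
proof -
  have ex: "\<exists>!p. p \<in> \<Omega> \<times> L \<and> x = fst p + snd p"
    using fundamental by (simp add: fundamental_domain_def)
  show ?thesis
  proof (rule ex_ex1I)
    show "\<exists>\<omega>. \<omega> \<in> \<Omega> \<and> x - \<omega> \<in> L"
      using ex1_implies_ex[OF ex] by (metis SigmaE add_diff_cancel_left' fst_conv snd_conv)
    fix \<omega> \<omega>'
    assume *: "\<omega> \<in> \<Omega> \<and> x - \<omega> \<in> L" "\<omega>' \<in> \<Omega> \<and> x - \<omega>' \<in> L"
    have "(\<omega>, x - \<omega>) = (\<omega>', x - \<omega>')"
      using ex * by (elim ex1E) (metis (no_types, lifting) SigmaI add.commute diff_add_cancel fst_conv snd_conv)
    then show "\<omega> = \<omega>'"
      by simp
  qed
qed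

lemma rep_in: "rep x \<in> \<Omega>" and diff_rep: "x - rep x \<in> L"
  using theI'[OF unique_rep[of x]] by (auto simp: rep_def)

lemma rep_eqI: "\<omega> \<in> \<Omega> \<Longrightarrow> x - \<omega> \<in> L \<Longrightarrow> rep x = \<omega>"
  using unique_rep[of x] rep_in diff_rep by blast

lemma rep_Omega: "\<omega> \<in> \<Omega> \<Longrightarrow> rep \<omega> = \<omega>"
  by (rule rep_eqI) (simp_all add: lattice_of_zero)

lemma rep_cong: "x - y \<in> L \<Longrightarrow> rep x = rep y"
  using lattice_of_add[OF _ diff_rep, of "x - y" y] by (intro rep_eqI rep_in) simp

lemma rep_rep_add: "rep (rep x + t) = rep (x + t)"
proof (rule rep_cong)
  show "rep x + t - (x + t) \<in> L"
    using lattice_of_minus[OF diff_rep[of x]] by simp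
qed

lemma periodic_ext_eq: "periodic_ext A \<Omega> f x = f (rep x)"
  by (simp add: periodic_ext_def rep_def)

lemma translate_sets: "B \<in> sets lebesgue \<Longrightarrow> (+) s ` B \<in> sets lebesgue"
  for B :: "(real^'n) set"
  by (rule lebesgue_sets_translation)

text \<open>Moving the intersection back by s exchanges which of the two sets is translated. Summed
  over the lattice, this trades a decomposition of one set for a decomposition of the other.\<close>

lemma emeasure_inter_translate:
  fixes B :: "(real^'n) set"
  shows "emeasure lebesgue (C \<inter> (+) s ` B) = emeasure lebesgue ((+) (- s) ` C \<inter> B)"
proof -
  have "(+) s ` ((+) (- s) ` C \<inter> B) = C \<inter> (+) s ` B"
    by (force simp: image_iff)
  then show ?thesis
    using emeasure_lebesgue_translation[of s "(+) (- s) ` C \<inter> B"] by simp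
qed

text \<open>Both sides are the sum of the measures of the pieces \<open>\<Omega> \<inter> (B + l - t)\<close>.\<close>

lemma emeasure_rep_vimage:
  assumes B: "B \<in> sets lebesgue" "B \<subseteq> \<Omega>"
  shows "{x \<in> \<Omega>. rep (x + t) \<in> B} \<in> sets lebesgue"
    and "emeasure lebesgue {x \<in> \<Omega>. rep (x + t) \<in> B} = emeasure lebesgue B"
proof -
  have eq: "{x \<in> \<Omega>. rep (x + t) \<in> B} = (\<Union>l\<in>L. \<Omega> \<inter> (+) (l - t) ` B)"
  proof (intro set_eqI iffI)
    fix x assume x: "x \<in> {x \<in> \<Omega>. rep (x + t) \<in> B}"
    have "x = (x + t - rep (x + t) - t) + rep (x + t)"
      by simp
    then show "x \<in> (\<Union>l\<in>L. \<Omega> \<inter> (+) (l - t) ` B)"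
      using x diff_rep[of "x + t"] by blast
  next
    fix x assume "x \<in> (\<Union>l\<in>L. \<Omega> \<inter> (+) (l - t) ` B)"
    then obtain l b where *: "l \<in> L" "x \<in> \<Omega>" "b \<in> B" "x = l - t + b"
      by blast
    then have "rep (x + t) = b"
      using B by (intro rep_eqI) auto
    then show "x \<in> {x \<in> \<Omega>. rep (x + t) \<in> B}"
      using * by simp
  qed
  have sets1: "\<Omega> \<inter> (+) (l - t) ` B \<in> sets lebesgue" for l
    using translate_sets[OF B(1)] Omega_sets by blast
  have sets2: "(+) (- (l - t)) ` \<Omega> \<inter> B \<in> sets lebesgue" for l
    using translate_sets[OF Omega_sets] B(1) by blast
  show "{x \<in> \<Omega>. rep (x + t) \<in> B} \<in> sets lebesgue"
    unfolding eq using sets1 by (intro sets.countable_UN' countable_lattice_of) auto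
  have disj1: "disjoint_family_on (\<lambda>l. \<Omega> \<inter> (+) (l - t) ` B) L"
  proof (unfold disjoint_family_on_def, intro ballI impI, rule ccontr)
    fix l l' assume l: "l \<in> L" "l' \<in> L" "l \<noteq> l'"
      and ne: "\<Omega> \<inter> (+) (l - t) ` B \<inter> (\<Omega> \<inter> (+) (l' - t) ` B) \<noteq> {}"
    from ne obtain x b b' where x: "b \<in> B" "b' \<in> B" "x = l - t + b" "x = l' - t + b'"
      by blast
    have "rep (x + t) = b"
      using x l B by (intro rep_eqI) auto
    moreover have "rep (x + t) = b'"
      using x(2,4) l B by (intro rep_eqI) auto
    ultimately show False
      using x l by simp
  qed
  have B_eq: "B = (\<Union>l\<in>L. (+) (- (l - t)) ` \<Omega> \<inter> B)"
  proof -
    \<comment> \<open>Reducing b - t modulo L names the translate of \<Omega> that contains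
      b.\<close>
    have "\<exists>l\<in>L. b \<in> (+) (- (l - t)) ` \<Omega>" for b
    proof (rule bexI)
      show "- (b - t - rep (b - t)) \<in> L"
        using diff_rep by (rule lattice_of_minus)
      show "b \<in> (+) (- (- (b - t - rep (b - t)) - t)) ` \<Omega>"
        by (rule image_eqI[OF _ rep_in[of "b - t"]]) simp
    qed
    then show ?thesis
      by blast
  qed
  have disj2: "disjoint_family_on (\<lambda>l. (+) (- (l - t)) ` \<Omega> \<inter> B) L"
  proof (unfold disjoint_family_on_def, intro ballI impI, rule ccontr)
    fix l l' assume l: "l \<in> L" "l' \<in> L" "l \<noteq> l'"
      and ne: "((+) (- (l - t)) ` \<Omega> \<inter> B) \<inter> ((+) (- (l' - t)) ` \<Omega> \<inter> B) \<noteq> {}"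
    from ne obtain x w w' where x: "w \<in> \<Omega>" "w' \<in> \<Omega>" "x = - (l - t) + w" "x = - (l' - t) + w'"
      by blast
    have "rep (x - t) = w"
      using x l lattice_of_minus[of l A] by (intro rep_eqI) auto
    moreover have "rep (x - t) = w'"
      using x(2,4) l lattice_of_minus[of l' A] by (intro rep_eqI) auto
    ultimately show False
      using x l by simp
  qed
  have "emeasure lebesgue {x \<in> \<Omega>. rep (x + t) \<in> B} =
      (\<integral>\<^sup>+l. emeasure lebesgue (\<Omega> \<inter> (+) (l - t) ` B) \<partial>count_space L)"
    unfolding eq using sets1 disj1 by (intro emeasure_UN_countable countable_lattice_of) auto
  also have "\<dots> = (\<integral>\<^sup>+l. emeasure lebesgue ((+) (- (l - t)) ` \<Omega> \<inter> B) \<partial>count_space L)"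
    by (simp only: emeasure_inter_translate)
  also have "\<dots> = emeasure lebesgue (\<Union>l\<in>L. (+) (- (l - t)) ` \<Omega> \<inter> B)"
    using sets2 disj2 by (intro emeasure_UN_countable[symmetric] countable_lattice_of) auto
  also have "\<dots> = emeasure lebesgue B"
    using B_eq by simp
  finally show "emeasure lebesgue {x \<in> \<Omega>. rep (x + t) \<in> B} = emeasure lebesgue B" .
qed

lemma rep_measurable [measurable]: "(\<lambda>x. rep (x + t)) \<in> lebesgue_on \<Omega> \<rightarrow>\<^sub>M lebesgue_on \<Omega>"
proof (rule measurableI)
  fix B assume "B \<in> sets (lebesgue_on \<Omega>)"
  then have "B \<in> sets lebesgue" "B \<subseteq> \<Omega>"
    by (auto simp: sets_restrict_space_iff)
  then have "{x \<in> \<Omega>. rep (x + t) \<in> B} \<in> sets lebesgue"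
    by (rule emeasure_rep_vimage(1))
  moreover have "(\<lambda>x. rep (x + t)) -` B \<inter> space (lebesgue_on \<Omega>) = {x \<in> \<Omega>. rep (x + t) \<in> B}"
    by (auto simp: space_restrict_space)
  ultimately show "(\<lambda>x. rep (x + t)) -` B \<inter> space (lebesgue_on \<Omega>) \<in> sets (lebesgue_on \<Omega>)"
    by (auto simp: sets_restrict_space_iff)
qed (simp add: space_restrict_space rep_in)

text \<open>Translation on the quotient preserves the measure, so integrals over \<Omega> of
  periodic functions are translation invariant, however irregular \<Omega> is.\<close>

lemma distr_rep: "distr (lebesgue_on \<Omega>) (lebesgue_on \<Omega>) (\<lambda>x. rep (x + t)) = lebesgue_on \<Omega>"
proof (rule measure_eqI)
  fix B assume "B \<in> sets (distr (lebesgue_on \<Omega>) (lebesgue_on \<Omega>) (\<lambda>x. rep (x + t)))"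
  then have B: "B \<in> sets (lebesgue_on \<Omega>)" "B \<in> sets lebesgue" "B \<subseteq> \<Omega>"
    by (auto simp: sets_restrict_space_iff)
  have "(\<lambda>x. rep (x + t)) -` B \<inter> space (lebesgue_on \<Omega>) = {x \<in> \<Omega>. rep (x + t) \<in> B}"
    by (auto simp: space_restrict_space)
  then show "emeasure (distr (lebesgue_on \<Omega>) (lebesgue_on \<Omega>) (\<lambda>x. rep (x + t))) B = emeasure (lebesgue_on \<Omega>) B"
    using B emeasure_rep_vimage[OF B(2,3), of t]
    by (subst emeasure_distr) (auto simp: emeasure_restrict_space)
qed simp

lemma integral_rep:
  fixes f :: "real^'n \<Rightarrow> 'b::{banach, second_countable_topology}"
  assumes "f \<in> borel_measurable (lebesgue_on \<Omega>)"
  shows "(LINT x|lebesgue_on \<Omega>. f (rep (x + t))) = (LINT x|lebesgue_on \<Omega>. f x)"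
  using integral_distr[OF rep_measurable[of t] assms] by (simp add: distr_rep)

lemma integrable_rep:
  fixes f :: "real^'n \<Rightarrow> 'b::{banach, second_countable_topology}"
  assumes "integrable (lebesgue_on \<Omega>) f"
  shows "integrable (lebesgue_on \<Omega>) (\<lambda>x. f (rep (x + t)))"
  by (rule integrable_distr[OF rep_measurable[of t]]) (simp add: distr_rep assms)

text \<open>The half-open parallelepiped spanned by the columns of A: a bounded fundamental domain
  to compare with \<Omega>, which may itself be unbounded.\<close>

definition cell :: "(real^'n) set" where
  "cell = {x. \<forall>i. 0 \<le> (matrix_inv A *v x) $ i \<and> (matrix_inv A *v x) $ i < 1}"

lemma A_inv: "A *v (matrix_inv A *v x) = x" "matrix_inv A *v (A *v x) = x"
  using invertible_A by (simp_all add: matrix_vector_mul_assoc matrix_inv_left matrix_inv_right)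

lemma cell_sets: "cell \<in> sets lebesgue"
proof -
  have [measurable]: "(\<lambda>x. (matrix_inv A *v x) $ i) \<in> borel_measurable borel" for i
    by (intro borel_measurable_continuous_onI continuous_intros linear_continuous_on) simp
  have "cell \<in> sets borel"
    unfolding cell_def by measurable
  then show ?thesis
    by simp
qed

lemma emeasure_cell: "emeasure lebesgue cell < \<infinity>"
proof -
  have "cell \<subseteq> (\<lambda>y. A *v y) ` cbox 0 (\<chi> i. 1)"
  proof
    fix x assume "x \<in> cell"
    then have "matrix_inv A *v x \<in> cbox 0 (\<chi> i. 1)"
      by (auto simp: cell_def mem_box_cart less_imp_le)
    then show "x \<in> (\<lambda>y. A *v y) ` cbox 0 (\<chi> i. 1)"
      by (metis A_inv(1) image_eqI)
  qed
  moreover have "compact ((\<lambda>y. A *v y) ` cbox 0 (\<chi> i. 1))"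
    by (intro compact_continuous_image linear_continuous_on) simp_all
  ultimately have "bounded cell"
    using bounded_subset compact_imp_bounded by blast
  then show ?thesis
    using bounded_set_imp_lmeasurable[OF _ cell_sets] by (simp add: fmeasurable_def del: emeasure_completion)
qed

lemma cell_translates_unique:
  assumes "l \<in> L" "l' \<in> L" "x - l \<in> cell" "x - l' \<in> cell"
  shows "l = l'"
proof -
  obtain z z' where z: "l = A *v z" "l' = A *v z'" "\<And>i. z $ i \<in> \<int>" "\<And>i. z' $ i \<in> \<int>"
    using assms(1,2) unfolding lattice_of_def by blast
  have "z $ i = z' $ i" for i
  proof -
    let ?y = "(matrix_inv A *v x) $ i"
    have "0 \<le> ?y - z $ i" "?y - z $ i < 1" "0 \<le> ?y - z' $ i" "?y - z' $ i < 1"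
      using assms(3,4) by (auto simp: cell_def z matrix_vector_mult_diff_distrib A_inv)
    moreover obtain m m' :: int where "z $ i = of_int m" "z' $ i = of_int m'"
      using z(3,4) by (metis Ints_cases)
    ultimately show ?thesis
      by (simp; linarith)
  qed
  then show ?thesis
    by (metis z(1,2) vec_eq_iff)
qed

lemma cell_translates_cover: "\<exists>l\<in>L. x - l \<in> cell"
proof
  let ?l = "A *v (\<chi> i. of_int \<lfloor>(matrix_inv A *v x) $ i\<rfloor>)"
  show "?l \<in> L"
    unfolding lattice_of_def by auto
  show "x - ?l \<in> cell"
    by (auto simp: cell_def matrix_vector_mult_diff_distrib A_inv) linarith
qed

text \<open>Cut \<Omega> along the translates of \<open>cell\<close> and move every piece into
  \<open>cell\<close>. The moved pieces stay disjoint because a point has only one representative in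
  \<Omega>, so the volume of \<open>cell\<close> is an upper bound.\<close>

lemma emeasure_Omega_finite: "emeasure lebesgue \<Omega> < \<infinity>"
proof -
  have eq: "\<Omega> = (\<Union>l\<in>L. \<Omega> \<inter> (+) l ` cell)"
  proof -
    have "\<exists>l\<in>L. x \<in> (+) l ` cell" for x
      using cell_translates_cover[of x] by (metis add.commute diff_add_cancel image_eqI)
    then show ?thesis
      by blast
  qed
  have sets1: "\<Omega> \<inter> (+) l ` cell \<in> sets lebesgue" for l
    using translate_sets[OF cell_sets] Omega_sets by blast
  have sets2: "(+) (- l) ` \<Omega> \<inter> cell \<in> sets lebesgue" for l
    using translate_sets[OF Omega_sets] cell_sets by blast
  have disj1: "disjoint_family_on (\<lambda>l. \<Omega> \<inter> (+) l ` cell) L"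
  proof (unfold disjoint_family_on_def, intro ballI impI, rule ccontr)
    fix l l' assume l: "l \<in> L" "l' \<in> L" "l \<noteq> l'"
      and ne: "\<Omega> \<inter> (+) l ` cell \<inter> (\<Omega> \<inter> (+) l' ` cell) \<noteq> {}"
    from ne obtain x b b' where "b \<in> cell" "b' \<in> cell" "x = l + b" "x = l' + b'"
      by blast
    then have "x - l \<in> cell" "x - l' \<in> cell"
      by (metis add_diff_cancel_left')+
    then show False
      using cell_translates_unique l by blast
  qed
  have disj2: "disjoint_family_on (\<lambda>l. (+) (- l) ` \<Omega> \<inter> cell) L"
  proof (unfold disjoint_family_on_def, intro ballI impI, rule ccontr)
    fix l l' assume l: "l \<in> L" "l' \<in> L" "l \<noteq> l'"
      and ne: "((+) (- l) ` \<Omega> \<inter> cell) \<inter> ((+) (- l') ` \<Omega> \<inter> cell) \<noteq> {}"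
    from ne obtain x w w' where x: "w \<in> \<Omega>" "w' \<in> \<Omega>" "x = - l + w" "x = - l' + w'"
      by blast
    have "rep x = w"
      using x(1,3) l(1) lattice_of_minus[of l A] by (intro rep_eqI) auto
    moreover have "rep x = w'"
      using x(2,4) l(2) lattice_of_minus[of l' A] by (intro rep_eqI) auto
    ultimately show False
      using x l by simp
  qed
  have "emeasure lebesgue \<Omega> = emeasure lebesgue (\<Union>l\<in>L. \<Omega> \<inter> (+) l ` cell)"
    using eq by simp
  also have "\<dots> = (\<integral>\<^sup>+l. emeasure lebesgue (\<Omega> \<inter> (+) l ` cell) \<partial>count_space L)"
    using sets1 disj1 by (intro emeasure_UN_countable countable_lattice_of) auto
  also have "\<dots> = (\<integral>\<^sup>+l. emeasure lebesgue ((+) (- l) ` \<Omega> \<inter> cell) \<partial>count_space L)"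
    by (simp only: emeasure_inter_translate)
  also have "\<dots> = emeasure lebesgue (\<Union>l\<in>L. (+) (- l) ` \<Omega> \<inter> cell)"
    using sets2 disj2 by (intro emeasure_UN_countable[symmetric] countable_lattice_of) auto
  also have "\<dots> \<le> emeasure lebesgue cell"
    using cell_sets by (intro emeasure_mono) auto
  finally show ?thesis
    using emeasure_cell by (rule le_less_trans)
qed

text \<open>Countably many lattice translates of \<Omega> cover the space, so they cannot all be
  null.\<close>

lemma measure_Omega_pos: "0 < measure lebesgue \<Omega>"
proof (rule ccontr)
  assume "\<not> 0 < measure lebesgue \<Omega>"
  then have "measure lebesgue \<Omega> = 0"
    by (simp add: zero_less_measure_iff)
  \<comment> \<open>\<open>measure\<close> is 0 on sets of infinite measure as well, so this
    conclusion rests on \<open>emeasure_Omega_finite\<close>.\<close>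
  then have 0: "emeasure lebesgue \<Omega> = 0"
    using emeasure_Omega_finite emeasure_eq_ennreal_measure[of lebesgue \<Omega>] by (simp del: emeasure_completion)
  have "(+) l ` \<Omega> \<in> null_sets lebesgue" for l
    using 0 translate_sets[OF Omega_sets] by (simp add: null_sets_def emeasure_lebesgue_translation)
  then have "(\<Union>l\<in>L. (+) l ` \<Omega>) \<in> null_sets lebesgue"
    by (intro null_sets_UN' countable_lattice_of)
  moreover have "x \<in> (\<Union>l\<in>L. (+) l ` \<Omega>)" for x
    by (intro UN_I[OF diff_rep[of x]] image_eqI[OF _ rep_in[of x]]) simp
  then have "(\<Union>l\<in>L. (+) l ` \<Omega>) = UNIV"
    by blast
  ultimately show False
    by (simp add: null_sets_def)
qed

lemma finite_measure_Omega: "finite_measure (lebesgue_on \<Omega>)"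
  using emeasure_Omega_finite
  by (intro finite_measureI) (simp add: space_restrict_space emeasure_restrict_space)

lemma measure_lebesgue_on_Omega: "measure (lebesgue_on \<Omega>) (space (lebesgue_on \<Omega>)) = measure lebesgue \<Omega>"
  by (simp add: space_restrict_space measure_restrict_space)

lemma character_rep:
  assumes "\<kappa> \<in> dual_lattice A"
  shows "character \<kappa> (rep x) = character \<kappa> x"
proof -
  have "character \<kappa> x = character \<kappa> (rep x + (x - rep x))"
    by simp
  also have "\<dots> = character \<kappa> (rep x) * character \<kappa> (x - rep x)"
    by (rule character_add)
  also have "character \<kappa> (x - rep x) = 1"
    using dual_lattice_inner_Ints[OF invertible_A assms diff_rep] by (simp add: character_eq_1_iff)
  finally show ?thesis
    by simp
qed

lemma integral_character:
  assumes "\<kappa> \<in> dual_lattice A" "\<kappa> \<noteq> 0"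
  shows "(LINT x|lebesgue_on \<Omega>. character \<kappa> x) = 0"
proof -
  \<comment> \<open>Half a period in the direction of \<kappa>: the inner product of \<kappa> and t
    is 1/2. Translating by t flips the sign of the integrand, so the invariant integral equals its
    own negative.\<close>
  define t where "t = (1 / (2 * (\<kappa> \<bullet> \<kappa>))) *\<^sub>R \<kappa>"
  have t: "character \<kappa> t = -1"
    using assms(2) by (simp add: character_def t_def)
  have "(LINT x|lebesgue_on \<Omega>. character \<kappa> x) = (LINT x|lebesgue_on \<Omega>. character \<kappa> (rep (x + t)))"
    by (rule integral_rep[symmetric]) measurable
  also have "\<dots> = - (LINT x|lebesgue_on \<Omega>. character \<kappa> x)"
    by (simp add: character_rep[OF assms(1)] character_add t)
  finally show ?thesis
    by simp
qed

section \<open>Fourier coefficients on \<Omega> as an instance of the abstract system\<close>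

sublocale unimodular_system "lebesgue_on \<Omega>" character "dual_lattice A"
proof (rule unimodular_system.intro[OF finite_measure_Omega], unfold_locales)
  show "0 < measure (lebesgue_on \<Omega>) (space (lebesgue_on \<Omega>))"
    unfolding measure_lebesgue_on_Omega by (rule measure_Omega_pos)
  show "countable (dual_lattice A)"
    unfolding dual_lattice_def by (rule countable_lattice_of)
  fix k l assume "k \<in> dual_lattice A" "l \<in> dual_lattice A" "k \<noteq> l"
  then have "k - l \<in> dual_lattice A" "k - l \<noteq> 0"
    unfolding dual_lattice_def by (auto intro: lattice_of_diff)
  then have "(LINT x|lebesgue_on \<Omega>. character (k - l) x) = 0"
    by (rule integral_character)
  then show "(LINT x|lebesgue_on \<Omega>. character k x * cnj (character l x)) = 0"
    using character_add_index[of k "- l"] by (simp add: character_minus_index)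
qed simp_all

lemma L2_space_eq: "L2_space \<Omega> = sq_integrable (lebesgue_on \<Omega>)"
  by (simp add: L2_space_def sq_integrable_def)

lemma L2_norm_eq: "L2_norm_on \<Omega> f = sqrt (energy f)"
  unfolding L2_norm_on_def energy_def measure_lebesgue_on_Omega by (rule refl)

lemma fourier_coeff_eq: "fourier_coeff \<Omega> f \<kappa> = coef f \<kappa>"
proof -
  have "exp (- 2 * complex_of_real pi * \<i> * complex_of_real (\<kappa> \<bullet> x)) = cnj (character \<kappa> x)" for x
  proof -
    have "cnj (character \<kappa> x) = cis (- (2 * pi * (\<kappa> \<bullet> x)))"
      by (simp add: character_def cis_cnj)
    then show ?thesis
      unfolding cis_conv_exp by (simp add: mult_ac)
  qed
  then show ?thesis
    unfolding fourier_coeff_def coef_def measure_lebesgue_on_Omega by simp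
qed

lemma sq_integrable_rep:
  assumes "f \<in> sq_integrable (lebesgue_on \<Omega>)"
  shows "(\<lambda>x. f (rep (x + t))) \<in> sq_integrable (lebesgue_on \<Omega>)"
  using integrable_rep[of "\<lambda>x. (norm (f x))\<^sup>2" t] measurable_compose[OF rep_measurable[of t], of f borel] assms
  by (simp add: sq_integrable_def)

lemma coef_rep:
  assumes f: "f \<in> sq_integrable (lebesgue_on \<Omega>)" and k: "\<kappa> \<in> dual_lattice A"
  shows "coef (\<lambda>x. f (rep (x + t))) \<kappa> = character \<kappa> t * coef f \<kappa>"
proof -
  note [measurable] = sq_integrableD[OF f]
  have "(LINT x|lebesgue_on \<Omega>. f x * cnj (character \<kappa> x)) =
      (LINT x|lebesgue_on \<Omega>. f (rep (x + t)) * cnj (character \<kappa> (rep (x + t))))"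
    by (rule integral_rep[symmetric]) measurable
  also have "\<dots> = (LINT x|lebesgue_on \<Omega>. cnj (character \<kappa> t) * (f (rep (x + t)) * cnj (character \<kappa> x)))"
    by (simp add: character_rep[OF k] character_add mult_ac)
  also have "\<dots> = cnj (character \<kappa> t) * (LINT x|lebesgue_on \<Omega>. f (rep (x + t)) * cnj (character \<kappa> x))"
    by simp
  finally show ?thesis
    by (simp add: coef_def mult_ac complex_norm_square[symmetric] flip: mult.assoc[of "character \<kappa> t" "cnj (character \<kappa> t)"])
qed

end

section \<open>Completeness of the characters\<close>

context lattice_domain
begin

text \<open>The orthogonal complement of the characters; completeness means that it consists of null
  functions.\<close>

definition annihilated :: "(real^'n \<Rightarrow> complex) set" where
  "annihilated = {f \<in> sq_integrable (lebesgue_on \<Omega>). \<forall>k\<in>dual_lattice A. coef f k = 0}"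

text \<open>Embeds the quotient by L in C^n through the characters of a basis of the dual lattice.
  Continuous functions are taken on C^n and pulled back, since \<Omega> carries no suitable topology
  of its own.\<close>

definition torus_map :: "real^'n \<Rightarrow> complex^'n" where
  "torus_map x = (\<chi> j. character (matrix_inv (transpose A) *v axis j 1) x)"

lemma dual_basis_in: "matrix_inv (transpose A) *v axis j 1 \<in> dual_lattice A"
  unfolding dual_lattice_def lattice_of_def by (auto simp: axis_def)

lemma continuous_on_torus_map: "continuous_on S torus_map"
  unfolding torus_map_def[abs_def] by (intro continuous_intros)

lemma norm_torus_map: "norm (torus_map x) \<le> real CARD('n)"
proof -
  have "norm (torus_map x) \<le> (\<Sum>j\<in>UNIV. norm (torus_map x $ j))"
    unfolding norm_vec_def by (intro L2_set_le_sum) simp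
  then show ?thesis
    by (simp add: torus_map_def)
qed

lemma torus_map_eq_imp:
  assumes "torus_map x = torus_map y"
  shows "x - y \<in> L"
proof -
  let ?k = "\<lambda>j. matrix_inv (transpose A) *v axis j 1"
  let ?w = "matrix_inv A *v (x - y)"
  have "?w $ j \<in> \<int>" for j
  proof -
    have "character (?k j) x = character (?k j) y"
      using assms by (simp add: torus_map_def vec_eq_iff)
    moreover have "character (?k j) x = character (?k j) (x - y) * character (?k j) y"
      using character_add[of "?k j" "x - y" y] by simp
    moreover have "character (?k j) y \<noteq> 0"
      using norm_character[of "?k j" y] by (metis norm_zero zero_neq_one)
    ultimately have "?k j \<bullet> (x - y) \<in> \<int>"
      by (simp add: character_eq_1_iff[symmetric])
    also have "?k j \<bullet> (x - y) = ?k j \<bullet> (A *v ?w)"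
      by (simp add: A_inv)
    also have "\<dots> = axis j 1 \<bullet> ?w"
      by (rule dual_lattice_inner[OF invertible_A])
    also have "\<dots> = ?w $ j"
      by (simp add: inner_axis')
    finally show ?thesis .
  qed
  then show ?thesis
    unfolding lattice_of_def using A_inv(1)[of "x - y", symmetric] by blast
qed

lemma inj_on_torus_map: "inj_on torus_map \<Omega>"
  by (intro inj_onI) (metis torus_map_eq_imp rep_cong rep_Omega)

lemma annihilated_add:
  "f \<in> annihilated \<Longrightarrow> g \<in> annihilated \<Longrightarrow> (\<lambda>x. f x + g x) \<in> annihilated"
  by (auto simp: annihilated_def sq_integrable_add coef_add)

lemma annihilated_cmult: "f \<in> annihilated \<Longrightarrow> (\<lambda>x. c * f x) \<in> annihilated"
  by (auto simp: annihilated_def sq_integrable_cmult coef_cmult)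

text \<open>Multiplication by a character only shifts the coefficients within the dual
  lattice.\<close>

lemma annihilated_character:
  assumes f: "f \<in> annihilated" and k: "k \<in> dual_lattice A"
  shows "(\<lambda>x. character k x * f x) \<in> annihilated"
proof -
  have "coef (\<lambda>x. character k x * f x) l = coef f (l - k)" for l
    using character_add_index[of l "- k"]
    by (simp add: coef_def character_minus_index mult_ac)
  moreover have "l - k \<in> dual_lattice A" if "l \<in> dual_lattice A" for l
    using that k unfolding dual_lattice_def by (rule lattice_of_diff)
  moreover have "(\<lambda>x. character k x * f x) \<in> sq_integrable (lebesgue_on \<Omega>)"
    using f by (intro sq_integrable_bounded_mult[where B = 1]) (auto simp: annihilated_def)
  ultimately show ?thesis
    using f by (simp add: annihilated_def)
qed

lemma integral_annihilated:
  assumes "f \<in> annihilated"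
  shows "(LINT x|lebesgue_on \<Omega>. f x) = 0"
proof -
  have "coef f 0 = 0"
    using assms lattice_of_zero by (auto simp: annihilated_def dual_lattice_def)
  then show ?thesis
    using measure_pos by (simp add: coef_def)
qed

text \<open>An algebra made for Stone-Weierstrass in place of explicit trigonometric polynomials:
  closure under sums and products is immediate, and the real and imaginary parts of the coordinates,
  which separate points, belong to it.\<close>

definition multiplier :: "(complex^'n \<Rightarrow> real) \<Rightarrow> bool" where
  "multiplier g \<longleftrightarrow> continuous_on UNIV g \<and>
     (\<forall>f\<in>annihilated. (\<lambda>x. complex_of_real (g (torus_map x)) * f x) \<in> annihilated)"

lemma multiplier_add: "multiplier f \<Longrightarrow> multiplier g \<Longrightarrow> multiplier (\<lambda>x. f x + g x)"
  by (auto simp: multiplier_def distrib_right intro!: continuous_intros annihilated_add)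

lemma multiplier_mult:
  assumes "multiplier f" "multiplier g"
  shows "multiplier (\<lambda>x. f x * g x)"
  unfolding multiplier_def
proof (intro conjI ballI)
  fix u assume "u \<in> annihilated"
  then have "(\<lambda>x. complex_of_real (g (torus_map x)) * u x) \<in> annihilated"
    using assms(2) by (simp add: multiplier_def)
  then have "(\<lambda>x. complex_of_real (f (torus_map x)) * (complex_of_real (g (torus_map x)) * u x)) \<in> annihilated"
    using assms(1) by (simp add: multiplier_def)
  then show "(\<lambda>x. complex_of_real (f (torus_map x) * g (torus_map x)) * u x) \<in> annihilated"
    by (simp add: mult.assoc)
qed (use assms in \<open>auto simp: multiplier_def intro: continuous_intros\<close>)

text \<open>On the torus, the real part of a coordinate is half the sum of a character and its
  conjugate, and both of these preserve \<open>annihilated\<close>.\<close>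

lemma multiplier_Re: "multiplier (\<lambda>z. Re (z $ j))"
  unfolding multiplier_def
proof (intro conjI ballI)
  let ?k = "matrix_inv (transpose A) *v axis j 1"
  have k: "- ?k \<in> dual_lattice A"
    using dual_basis_in unfolding dual_lattice_def by (rule lattice_of_minus)
  fix f assume f: "f \<in> annihilated"
  have "(\<lambda>x. 1/2 * (character ?k x * f x + character (- ?k) x * f x)) \<in> annihilated"
    by (intro annihilated_cmult annihilated_add annihilated_character f k dual_basis_in)
  moreover have "1/2 * (character ?k x * f x + character (- ?k) x * f x) =
      complex_of_real (Re (torus_map x $ j)) * f x" for x
    by (simp add: torus_map_def character_minus_index complex_add_cnj flip: distrib_right)
  ultimately show "(\<lambda>x. complex_of_real (Re (torus_map x $ j)) * f x) \<in> annihilated"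
    by simp
qed (intro continuous_intros)

lemma multiplier_Im: "multiplier (\<lambda>z. Im (z $ j))"
  unfolding multiplier_def
proof (intro conjI ballI)
  let ?k = "matrix_inv (transpose A) *v axis j 1"
  have k: "- ?k \<in> dual_lattice A"
    using dual_basis_in unfolding dual_lattice_def by (rule lattice_of_minus)
  fix f assume f: "f \<in> annihilated"
  have "(\<lambda>x. - \<i>/2 * (character ?k x * f x + (- 1) * (character (- ?k) x * f x))) \<in> annihilated"
    by (intro annihilated_cmult annihilated_add annihilated_character f k dual_basis_in)
  moreover have "- \<i>/2 * (character ?k x * f x + (- 1) * (character (- ?k) x * f x)) =
      complex_of_real (Im (torus_map x $ j)) * f x" for x
    by (simp add: torus_map_def character_minus_index complex_eq_iff field_simps)
  ultimately show "(\<lambda>x. complex_of_real (Im (torus_map x $ j)) * f x) \<in> annihilated"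
    by simp
qed (intro continuous_intros)

lemma torus_map_compose_measurable:
  assumes "continuous_on UNIV (g :: complex^'n \<Rightarrow> real)"
  shows "(\<lambda>x. g (torus_map x)) \<in> borel_measurable (lebesgue_on \<Omega>)"
proof -
  have "(\<lambda>x. g (torus_map x)) \<in> borel_measurable borel"
    by (intro borel_measurable_continuous_onI continuous_on_compose2[OF assms continuous_on_torus_map]) auto
  then have "(\<lambda>x. g (torus_map x)) \<in> borel_measurable lebesgue"
    by (simp add: measurable_completion)
  then show ?thesis
    by (rule measurable_restrict_space1)
qed

text \<open>On a ball containing the image of \<open>torus_map\<close>, g is uniformly close to some
  \<open>multiplier\<close> p. The product of p with f is again annihilated, and its integral is a
  multiple of its coefficient at 0, hence vanishes.\<close>

lemma integral_continuous_annihilated: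
  assumes g: "continuous_on UNIV g" and f: "f \<in> annihilated"
  shows "(LINT x|lebesgue_on \<Omega>. complex_of_real (g (torus_map x)) * f x) = 0"
proof -
  let ?S = "cball 0 (real CARD('n)) :: (complex^'n) set"
  let ?I = "\<lambda>g. LINT x|lebesgue_on \<Omega>. complex_of_real (g (torus_map x)) * f x"
  have f': "f \<in> sq_integrable (lebesgue_on \<Omega>)"
    using f by (simp add: annihilated_def)
  note [measurable] = sq_integrableD[OF f']
  have inS: "torus_map x \<in> ?S" for x
    using norm_torus_map[of x] by simp
  have bd: "norm (?I g) \<le> e * (LINT x|lebesgue_on \<Omega>. norm (f x))" if e: "e > 0" for e
  proof -
    have "\<exists>p. multiplier p \<and> (\<forall>x \<in> ?S. \<bar>g x - p x\<bar> < e)"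
    proof (rule Stone_Weierstrass_HOL)
      show "multiplier (\<lambda>x. c)" for c
        by (auto simp: multiplier_def intro: annihilated_cmult)
      show "continuous_on ?S p" if "multiplier p" for p
        using that by (auto simp: multiplier_def intro: continuous_on_subset)
      show "\<exists>p. multiplier p \<and> p x \<noteq> p y" if xy: "x \<in> ?S \<and> y \<in> ?S \<and> x \<noteq> y" for x y :: "complex^'n"
      proof -
        obtain j where "x $ j \<noteq> y $ j"
          using xy by (auto simp: vec_eq_iff)
        then have "Re (x $ j) \<noteq> Re (y $ j) \<or> Im (x $ j) \<noteq> Im (y $ j)"
          using complex_eq_iff by blast
        then show ?thesis
          using multiplier_Re[of j] multiplier_Im[of j] by blast
      qed
      show "continuous_on ?S g"
        using g by (rule continuous_on_subset) simp
    qed (use multiplier_add multiplier_mult e in auto)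
    then obtain p where p: "multiplier p" "\<And>x. \<bar>g (torus_map x) - p (torus_map x)\<bar> < e"
      using inS by blast
    have cont: "continuous_on UNIV (\<lambda>z. g z - p z)"
      using g p by (auto simp: multiplier_def intro: continuous_intros)
    note [measurable] = torus_map_compose_measurable[OF g] torus_map_compose_measurable[OF cont]
    have "?I p = 0"
      using p f by (intro integral_annihilated) (auto simp: multiplier_def)
    have ip: "integrable (lebesgue_on \<Omega>) (\<lambda>x. complex_of_real (p (torus_map x)) * f x)"
      using p f by (intro sq_integrable_imp_integrable) (auto simp: multiplier_def annihilated_def)
    have id: "integrable (lebesgue_on \<Omega>) (\<lambda>x. complex_of_real (g (torus_map x) - p (torus_map x)) * f x)"
    proof (intro sq_integrable_imp_integrable sq_integrable_bounded_mult[OF f', where B = e])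
      show "norm (complex_of_real (g (torus_map x) - p (torus_map x))) \<le> e" for x
        using p(2)[of x] by (simp only: norm_of_real)
    qed measurable
    have "?I g = (LINT x|lebesgue_on \<Omega>. complex_of_real (g (torus_map x) - p (torus_map x)) * f x +
        complex_of_real (p (torus_map x)) * f x)"
      by (simp add: algebra_simps)
    also have "\<dots> = (LINT x|lebesgue_on \<Omega>. complex_of_real (g (torus_map x) - p (torus_map x)) * f x)"
      using ip id \<open>?I p = 0\<close> by (subst Bochner_Integration.integral_add) auto
    also have "norm \<dots> \<le> (LINT x|lebesgue_on \<Omega>. norm (complex_of_real (g (torus_map x) - p (torus_map x)) * f x))"
      by (rule integral_norm_bound)
    also have "\<dots> \<le> (LINT x|lebesgue_on \<Omega>. e * norm (f x))"
    proof (rule integral_mono)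
      show "norm (complex_of_real (g (torus_map x) - p (torus_map x)) * f x) \<le> e * norm (f x)" for x
        unfolding norm_mult norm_of_real using p(2)[of x] by (intro mult_right_mono) auto
    qed (use id sq_integrable_imp_integrable[OF f'] in \<open>auto intro: integrable_norm\<close>)
    finally show ?thesis
      by simp
  qed
  have "norm (?I g) \<le> 0"
  proof (rule tendsto_lowerbound)
    show "((\<lambda>e. e * (LINT x|lebesgue_on \<Omega>. norm (f x))) \<longlongrightarrow> 0) (at_right 0)"
      by (auto intro!: tendsto_eq_intros)
    show "\<forall>\<^sub>F e in at_right 0. norm (?I g) \<le> e * (LINT x|lebesgue_on \<Omega>. norm (f x))"
      using bd by (auto simp: eventually_at_filter)
  qed simp
  then show ?thesis
    by simp
qed

text \<open>The indicator of C is a limit of continuous functions of \<open>torus_map x\<close>: the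
  image K of C is closed, and injectivity on \<Omega> lets only points of C land in K.\<close>

lemma integral_compact_annihilated:
  assumes f: "f \<in> annihilated" and C: "compact C" "C \<subseteq> \<Omega>"
  shows "(LINT x|lebesgue_on \<Omega>. indicator C x *\<^sub>R f x) = 0"
proof (cases "C = {}")
  case False
  define K where "K = torus_map ` C"
  have K: "closed K" "K \<noteq> {}"
    using C False compact_continuous_image[OF continuous_on_torus_map C(1)]
    by (auto simp: K_def compact_imp_closed)
  have f': "f \<in> sq_integrable (lebesgue_on \<Omega>)"
    using f by (simp add: annihilated_def)
  \<comment> \<open>Tents of slope n around K: equal to 1 on K, and eventually 0 at each point off
    K, whose distance to the closed set K is positive.\<close>
  define g where "g n z = max 0 (1 - real n * infdist z K)" for n z
  have g: "continuous_on UNIV (g n)" for n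
    unfolding g_def[abs_def] by (intro continuous_intros)
  note [measurable] = sq_integrableD[OF f'] torus_map_compose_measurable[OF g]
  have "C \<in> sets (lebesgue_on \<Omega>)"
    using C by (simp add: sets_restrict_space_iff lmeasurable_compact fmeasurableD)
  then have [measurable]: "(\<lambda>x. indicator C x *\<^sub>R f x) \<in> borel_measurable (lebesgue_on \<Omega>)"
    by measurable
  have lim: "(\<lambda>n. complex_of_real (g n (torus_map x)) * f x) \<longlonglongrightarrow> indicator C x *\<^sub>R f x" if "x \<in> \<Omega>" for x
  proof -
    have eq: "torus_map x \<in> K \<longleftrightarrow> x \<in> C"
      using inj_on_torus_map C(2) that by (auto simp: K_def inj_on_def)
    have "(\<lambda>n. g n (torus_map x)) \<longlonglongrightarrow> indicator C x"
    proof (cases "x \<in> C")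
      case True
      then have "infdist (torus_map x) K = 0"
        using eq by simp
      then show ?thesis
        using True by (simp add: g_def)
    next
      case F: False
      then have "infdist (torus_map x) K > 0"
        using eq K infdist_pos_not_in_closed by blast
      then have "\<forall>\<^sub>F n in sequentially. g n (torus_map x) = 0"
        using eventually_ge_at_top[of "nat \<lceil>1 / infdist (torus_map x) K\<rceil>"]
      proof (elim eventually_mono)
        fix n assume *: "0 < infdist (torus_map x) K" "nat \<lceil>1 / infdist (torus_map x) K\<rceil> \<le> n"
        then have "1 / infdist (torus_map x) K \<le> real n"
          by linarith
        then show "g n (torus_map x) = 0"
          using *(1) by (simp add: g_def field_simps)
      qed
      then show ?thesis
        using F by (simp add: tendsto_eventually)
    qed
    then have "(\<lambda>n. complex_of_real (g n (torus_map x)) * f x) \<longlonglongrightarrow> complex_of_real (indicator C x) * f x"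
      by (intro tendsto_intros)
    then show ?thesis
      by (simp add: scaleR_conv_of_real)
  qed
  have "(\<lambda>n. LINT x|lebesgue_on \<Omega>. complex_of_real (g n (torus_map x)) * f x) \<longlonglongrightarrow>
      (LINT x|lebesgue_on \<Omega>. indicator C x *\<^sub>R f x)"
  proof (rule integral_dominated_convergence)
    show "integrable (lebesgue_on \<Omega>) (\<lambda>x. norm (f x))"
      using f' by (intro integrable_norm sq_integrable_imp_integrable)
    show "AE x in lebesgue_on \<Omega>. (\<lambda>n. complex_of_real (g n (torus_map x)) * f x) \<longlonglongrightarrow> indicator C x *\<^sub>R f x"
      using lim by (intro AE_I2) (simp add: space_restrict_space)
    show "AE x in lebesgue_on \<Omega>. norm (complex_of_real (g n (torus_map x)) * f x) \<le> norm (f x)" for n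
    proof (rule AE_I2)
      fix x
      have "0 \<le> g n (torus_map x)" "g n (torus_map x) \<le> 1"
        by (auto simp: g_def infdist_nonneg)
      then show "norm (complex_of_real (g n (torus_map x)) * f x) \<le> norm (f x)"
        by (simp add: norm_mult mult_left_le_one_le)
    qed
  qed measurable
  then show ?thesis
    using integral_continuous_annihilated[OF g f] by (simp add: LIMSEQ_const_iff)
qed simp

text \<open>An integrable function is null once its integral over every measurable set vanishes.
  Inner regularity reduces such a set to compact ones, up to a null set.\<close>

lemma annihilated_zero:
  assumes f: "f \<in> annihilated"
  shows "AE x in lebesgue_on \<Omega>. f x = 0"
proof (rule density_zero)
  have f': "f \<in> sq_integrable (lebesgue_on \<Omega>)"
    using f by (simp add: annihilated_def)
  note [measurable] = sq_integrableD[OF f']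
  show int: "integrable (lebesgue_on \<Omega>) f"
    using f' by (rule sq_integrable_imp_integrable)
  fix S assume S_sets [measurable]: "S \<in> sets (lebesgue_on \<Omega>)"
  then have S: "S \<in> sets lebesgue" "S \<subseteq> \<Omega>"
    by (auto simp: sets_restrict_space_iff)
  obtain N C where NC: "negligible N" "\<And>n::nat. compact (C n)" "S = (\<Union>n. C n) \<union> N"
    using lebesgue_regular_inner[OF S(1)] by metis
  \<comment> \<open>The compact sets supplied by regularity come in no particular order; their
    finite unions are compact and increase to S off N.\<close>
  define D where "D n = (\<Union>i\<le>n. C i)" for n :: nat
  have D: "compact (D n)" "D n \<subseteq> \<Omega>" for n
    using NC S(2) by (auto simp: D_def)
  have [measurable]: "D n \<in> sets (lebesgue_on \<Omega>)" for n
    using D by (simp add: sets_restrict_space_iff lmeasurable_compact fmeasurableD)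
  have lim: "(\<lambda>n. indicator (D n) x *\<^sub>R f x) \<longlonglongrightarrow> indicator S x *\<^sub>R f x" if xN: "x \<notin> N" for x
  proof (cases "x \<in> S")
    case True
    then obtain m where "x \<in> C m"
      using NC(3) xN by blast
    then have "\<forall>\<^sub>F n in sequentially. indicator (D n) x *\<^sub>R f x = indicator S x *\<^sub>R f x"
      using eventually_ge_at_top[of m] True by (elim eventually_mono) (auto simp: D_def indicator_def)
    then show ?thesis
      by (rule tendsto_eventually)
  next
    case False
    then have "x \<notin> D n" for n
      using NC by (auto simp: D_def)
    then show ?thesis
      using False by simp
  qed
  have AE: "AE x in lebesgue_on \<Omega>. x \<notin> N"
  proof -
    have "AE x in lebesgue. x \<notin> N"
      using NC(1) by (simp add: AE_not_in negligible_iff_null_sets)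
    then show ?thesis
      by (simp add: AE_restrict_space_iff) (auto elim: eventually_mono)
  qed
  have "(\<lambda>n. LINT x|lebesgue_on \<Omega>. indicator (D n) x *\<^sub>R f x) \<longlonglongrightarrow>
      (LINT x|lebesgue_on \<Omega>. indicator S x *\<^sub>R f x)"
  proof (rule integral_dominated_convergence)
    show "integrable (lebesgue_on \<Omega>) (\<lambda>x. norm (f x))"
      using int by (rule integrable_norm)
    show "AE x in lebesgue_on \<Omega>. (\<lambda>n. indicator (D n) x *\<^sub>R f x) \<longlonglongrightarrow> indicator S x *\<^sub>R f x"
      using AE lim by (auto elim: eventually_mono)
  qed (auto simp: indicator_def)
  then show "set_lebesgue_integral (lebesgue_on \<Omega>) S f = 0"
    using integral_compact_annihilated[OF f D] by (simp add: set_lebesgue_integral_def LIMSEQ_const_iff)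
qed

sublocale complete_unimodular_system "lebesgue_on \<Omega>" character "dual_lattice A"
  by unfold_locales (rule annihilated_zero, simp add: annihilated_def)

end

section \<open>Dyadic domination\<close>

text \<open>The squared modulus of exp(2 pi i u) - 1. A difference with step h in coordinate j
  multiplies the squared modulus of the coefficient at \<kappa> by its value at
  \<open>\<kappa> $ j * h\<close>.\<close>

definition diff_weight :: "real \<Rightarrow> real" where
  "diff_weight u = 4 * (sin (pi * u))\<^sup>2"

text \<open>Up to a constant, an upper bound for \<open>diff_weight (u * H)\<close> times the
  squared symbol decay when |u| lies between 2^i and 2^(i+1). With \<gamma> = 0 and H = 1 / N it
  also serves the cut-off at N.\<close>

definition dyadic_weight :: "real \<Rightarrow> real \<Rightarrow> nat \<Rightarrow> real" where
  "dyadic_weight \<gamma> H i = (min 1 (2 ^ i * H))\<^sup>2 * (1 / 2 ^ i) powr (2 * \<gamma>)"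

lemma diff_weight_nonneg: "0 \<le> diff_weight u"
  by (simp add: diff_weight_def)

lemma diff_weight_abs: "diff_weight \<bar>u\<bar> = diff_weight u"
  by (cases "u \<ge> 0") (simp_all add: diff_weight_def)

lemma dyadic_weight_nonneg: "0 \<le> dyadic_weight \<gamma> H i"
  by (simp add: dyadic_weight_def)

lemma norm_cis_minus_1: "(norm (cis (2 * pi * u) - 1))\<^sup>2 = diff_weight u"
proof -
  have "(norm (cis (2 * pi * u) - 1))\<^sup>2 = (cos (2 * pi * u) - 1)\<^sup>2 + (sin (2 * pi * u))\<^sup>2"
    by (simp add: cmod_power2)
  also have "\<dots> = 2 - 2 * cos (2 * pi * u)"
    using sin_cos_squared_add[of "2 * pi * u"] by (simp add: power2_diff)
  also have "\<dots> = 4 * (sin (pi * u))\<^sup>2"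
    using cos_double_sin[of "pi * u"] by (simp add: mult.assoc)
  finally show ?thesis
    by (simp add: diff_weight_def)
qed

lemma diff_weight_le: "diff_weight u \<le> 4 * pi\<^sup>2 * (min 1 \<bar>u\<bar>)\<^sup>2"
proof -
  have "\<bar>sin (pi * u)\<bar> \<le> pi * \<bar>u\<bar>"
    using abs_sin_x_le_abs_x[of "pi * u"] by (simp add: abs_mult)
  moreover have "\<bar>sin (pi * u)\<bar> \<le> pi"
    using abs_sin_le_one[of "pi * u"] pi_gt3 by linarith
  ultimately have "\<bar>sin (pi * u)\<bar> \<le> pi * min 1 \<bar>u\<bar>"
    by (simp add: min_def)
  then have "\<bar>sin (pi * u)\<bar>\<^sup>2 \<le> (pi * min 1 \<bar>u\<bar>)\<^sup>2"
    by (rule power_mono) simp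
  then show ?thesis
    by (simp add: diff_weight_def power_mult_distrib)
qed

text \<open>The Taylor remainder is at most y^3 / 6, hence at most y / 6 on the unit
  interval.\<close>

lemma sin_ge_half:
  fixes y :: real
  assumes "0 \<le> y" "y \<le> 1"
  shows "y / 2 \<le> sin y"
proof -
  have "\<bar>sin y - (\<Sum>m<3. sin_coeff m * y ^ m)\<bar> \<le> inverse (fact 3) * \<bar>y\<bar> ^ 3"
    by (rule Maclaurin_sin_bound)
  moreover have "(\<Sum>m<3. sin_coeff m * y ^ m) = y"
    by (simp add: sin_coeff_def eval_nat_numeral)
  moreover have "\<bar>y\<bar> ^ 3 \<le> y"
    using assms power_decreasing[of 1 3 y] by simp
  moreover have "inverse (fact 3) = (1/6::real)"
    by (simp add: fact_numeral)
  ultimately have "\<bar>sin y - y\<bar> \<le> 1/6 * y"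
    by simp
  then show ?thesis
    using assms by linarith
qed

text \<open>The range 1/4 comes from pi < 4: it puts the argument of the sine into the unit
  interval, where \<open>sin_ge_half\<close> applies.\<close>

lemma diff_weight_ge:
  assumes "\<bar>u\<bar> \<le> 1/4"
  shows "pi\<^sup>2 * u\<^sup>2 \<le> diff_weight u"
proof -
  have "pi * \<bar>u\<bar> \<le> 4 * (1/4)"
    using assms pi_less_4 by (intro mult_mono) auto
  then have "pi * \<bar>u\<bar> / 2 \<le> sin (pi * \<bar>u\<bar>)"
    by (intro sin_ge_half) auto
  then have "(pi * \<bar>u\<bar> / 2)\<^sup>2 \<le> (sin (pi * \<bar>u\<bar>))\<^sup>2"
    by (rule power_mono) simp
  then have "pi\<^sup>2 * u\<^sup>2 \<le> diff_weight \<bar>u\<bar>"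
    by (simp add: diff_weight_def power_mult_distrib power_divide)
  then show ?thesis
    by (simp add: diff_weight_abs)
qed

lemma dyadic_scale:
  assumes "1 \<le> (x::real)"
  obtains i :: nat where "2 ^ i \<le> x" "x < 2 ^ Suc i"
proof -
  define n where "n = (LEAST n::nat. x < 2 ^ n)"
  have "\<exists>n::nat. x < 2 ^ n"
    by (rule real_arch_pow) simp
  then have n: "x < 2 ^ n"
    unfolding n_def by (rule LeastI_ex)
  with assms have "n \<noteq> 0"
    by (intro notI) simp
  then obtain i where i: "n = Suc i"
    by (cases n) auto
  have "\<not> x < 2 ^ i"
    using not_less_Least[of i "\<lambda>n. x < 2 ^ n"] by (simp add: n_def[symmetric] i)
  then show thesis
    using that[of i] n i by simp
qed

text \<open>Origin of the bound 1/8: as |u| / 2^i is at most 2, the argument of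
  \<open>diff_weight\<close> stays within 1/4.\<close>

lemma diff_weight_dyadic_ge:
  assumes \<delta>: "0 < \<delta>" "\<delta> \<le> 1/8" and u: "\<bar>u\<bar> < 2 ^ Suc i"
  shows "pi\<^sup>2 * \<delta>\<^sup>2 * (u / 2 ^ i)\<^sup>2 \<le> diff_weight (u * (\<delta> / 2 ^ i))"
proof -
  have "\<bar>u\<bar> / 2 ^ i \<le> 2"
    using u by (simp add: field_simps)
  then have "\<bar>u\<bar> / 2 ^ i * \<delta> \<le> 2 * (1/8)"
    using \<delta> by (intro mult_mono) auto
  then have "\<bar>u * (\<delta> / 2 ^ i)\<bar> \<le> 1/4"
    using \<delta> by (simp add: abs_mult)
  then have "pi\<^sup>2 * (u * (\<delta> / 2 ^ i))\<^sup>2 \<le> diff_weight (u * (\<delta> / 2 ^ i))"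
    by (rule diff_weight_ge)
  then show ?thesis
    by (simp add: power_mult_distrib power_divide mult_ac)
qed

lemma japanese_bracket_ge: "1 \<le> japanese_bracket u" "\<bar>u\<bar> \<le> japanese_bracket u"
proof -
  show "1 \<le> japanese_bracket u"
    by (simp add: japanese_bracket_def)
  have "sqrt (\<bar>u\<bar>\<^sup>2) \<le> japanese_bracket u"
    unfolding japanese_bracket_def by (intro real_sqrt_le_mono) simp
  then show "\<bar>u\<bar> \<le> japanese_bracket u"
    by simp
qed

lemma powr_minus_antimono:
  assumes "0 < x" "x \<le> y" "0 \<le> g"
  shows "y powr (- g) \<le> x powr (- (g::real))"
  using assms by (intro powr_mono2') auto

lemma powr_square: "(x powr g)\<^sup>2 = x powr (2 * g)" for x g :: real
  by (simp add: power2_eq_square flip: powr_add)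

text \<open>The witness is the dyadic scale of |u|, or 0 when |u| < 1. At that scale the test
  difference is at least of order \<delta>^2 times (u / 2^i)^2, and the factor 16 / \<delta>^2
  compensates for \<delta>.\<close>

lemma symbol_dominated:
  assumes \<delta>: "0 < \<delta>" "\<delta> \<le> 1/8" and \<gamma>: "0 \<le> \<gamma>" and H: "\<bar>H\<bar> \<le> 1"
  shows "\<exists>i. diff_weight (u * H) * (japanese_bracket u powr (- \<gamma>))\<^sup>2 \<le>
    16 / \<delta>\<^sup>2 * dyadic_weight \<gamma> \<bar>H\<bar> i * diff_weight (u * (\<delta> / 2 ^ i))"
proof (cases "\<bar>u\<bar> < 1")
  case True
  \<comment> \<open>Low frequencies: both sides are of order u^2 H^2 at the coarsest scale, so the
    comparison survives down to u = 0.\<close>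
  have "diff_weight (u * H) * (japanese_bracket u powr (- \<gamma>))\<^sup>2 \<le> (4 * pi\<^sup>2 * (min 1 \<bar>u * H\<bar>)\<^sup>2) * 1\<^sup>2"
    using powr_minus_antimono[of 1 "japanese_bracket u" \<gamma>] japanese_bracket_ge[of u] \<gamma>
    by (intro mult_mono diff_weight_le power_mono) auto
  also have "\<dots> \<le> 4 * pi\<^sup>2 * (u\<^sup>2 * H\<^sup>2)"
  proof -
    have "(min 1 \<bar>u * H\<bar>)\<^sup>2 \<le> \<bar>u * H\<bar>\<^sup>2"
      by (intro power_mono) auto
    then show ?thesis
      by (simp add: power_mult_distrib)
  qed
  also have "\<dots> \<le> 16 * (pi\<^sup>2 * (u\<^sup>2 * H\<^sup>2))"
    by simp
  also have "\<dots> = 16 / \<delta>\<^sup>2 * H\<^sup>2 * (pi\<^sup>2 * \<delta>\<^sup>2 * (u / 2 ^ 0)\<^sup>2)"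
    using \<delta> by simp
  also have "\<dots> \<le> 16 / \<delta>\<^sup>2 * H\<^sup>2 * diff_weight (u * (\<delta> / 2 ^ 0))"
    using \<delta> True by (intro mult_left_mono diff_weight_dyadic_ge) auto
  also have "H\<^sup>2 = dyadic_weight \<gamma> \<bar>H\<bar> 0"
    using H by (simp add: dyadic_weight_def min_def)
  finally show ?thesis
    by blast
next
  case False
  then have "1 \<le> \<bar>u\<bar>"
    by simp
  then obtain i where i: "2 ^ i \<le> \<bar>u\<bar>" "\<bar>u\<bar> < 2 ^ Suc i"
    by (rule dyadic_scale)
  have "japanese_bracket u powr (- \<gamma>) \<le> (2 ^ i) powr (- \<gamma>)"
    using i(1) japanese_bracket_ge[of u] \<gamma> by (intro powr_minus_antimono) auto
  then have "(japanese_bracket u powr (- \<gamma>))\<^sup>2 \<le> ((2 ^ i) powr (- \<gamma>))\<^sup>2"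
    by (rule power_mono) simp
  also have "\<dots> = (1 / 2 ^ i) powr (2 * \<gamma>)"
    by (simp add: powr_square powr_minus_divide powr_divide power_divide)
  finally have 1: "(japanese_bracket u powr (- \<gamma>))\<^sup>2 \<le> (1 / 2 ^ i) powr (2 * \<gamma>)" .
  \<comment> \<open>Replacing |u| by 2^(i+1) costs a factor 2; its square turns the 4 of
    \<open>diff_weight_le\<close> into 16.\<close>
  have "min 1 \<bar>u * H\<bar> \<le> 2 * min 1 (2 ^ i * \<bar>H\<bar>)"
  proof -
    have "\<bar>u * H\<bar> \<le> 2 ^ Suc i * \<bar>H\<bar>"
      using i(2) by (simp add: abs_mult mult_right_mono)
    then show ?thesis
      by (simp add: min_def)
  qed
  then have "(min 1 \<bar>u * H\<bar>)\<^sup>2 \<le> (2 * min 1 (2 ^ i * \<bar>H\<bar>))\<^sup>2"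
    by (rule power_mono) simp
  then have "4 * pi\<^sup>2 * (min 1 \<bar>u * H\<bar>)\<^sup>2 \<le> 16 * pi\<^sup>2 * (min 1 (2 ^ i * \<bar>H\<bar>))\<^sup>2"
    by (simp add: power_mult_distrib)
  with diff_weight_le[of "u * H"] have 2: "diff_weight (u * H) \<le> 16 * pi\<^sup>2 * (min 1 (2 ^ i * \<bar>H\<bar>))\<^sup>2"
    by linarith
  have "diff_weight (u * H) * (japanese_bracket u powr (- \<gamma>))\<^sup>2 \<le>
      (16 * pi\<^sup>2 * (min 1 (2 ^ i * \<bar>H\<bar>))\<^sup>2) * (1 / 2 ^ i) powr (2 * \<gamma>)"
    by (intro mult_mono 1 2) auto
  also have "\<dots> = 16 / \<delta>\<^sup>2 * dyadic_weight \<gamma> \<bar>H\<bar> i * (pi\<^sup>2 * \<delta>\<^sup>2 * 1)"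
    using \<delta> by (simp add: dyadic_weight_def)
  also have "\<dots> \<le> 16 / \<delta>\<^sup>2 * dyadic_weight \<gamma> \<bar>H\<bar> i * (pi\<^sup>2 * \<delta>\<^sup>2 * (u / 2 ^ i)\<^sup>2)"
  proof (intro mult_left_mono)
    have "1 \<le> \<bar>u / 2 ^ i\<bar>\<^sup>2"
      using i(1) by (intro one_le_power) (simp add: field_simps)
    then show "1 \<le> (u / 2 ^ i)\<^sup>2"
      by (simp only: power2_abs)
  qed (use \<delta> dyadic_weight_nonneg in auto)
  also have "\<dots> \<le> 16 / \<delta>\<^sup>2 * dyadic_weight \<gamma> \<bar>H\<bar> i * diff_weight (u * (\<delta> / 2 ^ i))"
    using \<delta> i(2) by (intro mult_left_mono diff_weight_dyadic_ge) (auto simp: dyadic_weight_nonneg)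
  finally show ?thesis
    by blast
qed

lemma indicator_dominated:
  assumes \<delta>: "0 < \<delta>" "\<delta> \<le> 1/8" and N: "1 \<le> (N::real)"
  shows "\<exists>i. (if \<bar>u\<bar> > N then 1 else 0) \<le>
    16 / \<delta>\<^sup>2 * dyadic_weight 0 (1 / N) i * diff_weight (u * (\<delta> / 2 ^ i))"
proof (cases "\<bar>u\<bar> > N")
  case True
  then have "1 \<le> \<bar>u\<bar>"
    using N by simp
  then obtain i where i: "2 ^ i \<le> \<bar>u\<bar>" "\<bar>u\<bar> < 2 ^ Suc i"
    by (rule dyadic_scale)
  \<comment> \<open>From N < |u| < 2^(i+1). The factor 1/4 left after squaring is absorbed by 16
    pi^2.\<close>
  have "1/2 \<le> min 1 (2 ^ i * (1 / N))"
    using True i(2) N by (simp add: field_simps)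
  then have "(1/2)\<^sup>2 \<le> (min 1 (2 ^ i * (1 / N)))\<^sup>2"
    by (rule power_mono) simp
  then have w: "1/4 \<le> dyadic_weight 0 (1 / N) i"
    by (simp add: dyadic_weight_def power_divide)
  have "1 \<le> \<bar>u / 2 ^ i\<bar>\<^sup>2"
    using i(1) by (intro one_le_power) (simp add: field_simps)
  then have u2: "1 \<le> (u / 2 ^ i)\<^sup>2"
    by (simp only: power2_abs)
  have "(1::real) \<le> 3\<^sup>2"
    by simp
  also have "\<dots> \<le> pi\<^sup>2"
    using pi_gt3 by (intro power_mono) auto
  finally have "1 \<le> 4 * pi\<^sup>2"
    by simp
  also have "\<dots> = 16 / \<delta>\<^sup>2 * (1/4) * (pi\<^sup>2 * \<delta>\<^sup>2 * 1)"
    using \<delta> by simp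
  also have "\<dots> \<le> 16 / \<delta>\<^sup>2 * dyadic_weight 0 (1 / N) i * (pi\<^sup>2 * \<delta>\<^sup>2 * (u / 2 ^ i)\<^sup>2)"
    using \<delta> w u2 by (intro mult_mono) (auto simp: dyadic_weight_nonneg)
  also have "\<dots> \<le> 16 / \<delta>\<^sup>2 * dyadic_weight 0 (1 / N) i * diff_weight (u * (\<delta> / 2 ^ i))"
    using \<delta> i(2) by (intro mult_left_mono diff_weight_dyadic_ge) (auto simp: dyadic_weight_nonneg)
  finally show ?thesis
    using True by auto
next
  case False
  then show ?thesis
    by (auto simp: dyadic_weight_nonneg diff_weight_nonneg)
qed

text \<open>
  The sum splits at \<open>2\<^sup>m \<approx> 1/H\<close>: below, the terms grow geometrically because \<open>\<beta> < 1\<close>; above,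
  they decay geometrically because \<open>\<beta> > 0\<close>.
\<close>

lemma dyadic_weight_sum:
  assumes \<beta>: "0 < \<beta>" "\<beta> < 1"
  obtains B where "B > 0"
    "\<And>H n. 0 \<le> H \<Longrightarrow> H \<le> 1 \<Longrightarrow> (\<Sum>i\<le>n. dyadic_weight \<beta> H i) \<le> B * H powr (2 * \<beta>)"
proof -
  \<comment> \<open>q is the ratio of successive terms once the minimum in
    \<open>dyadic_weight\<close> has saturated at 1, and p = 4 q the ratio before that; 0 < \<beta>
    gives q < 1, and \<beta> < 1 gives p > 1.\<close>
  define q where "q = (1/4::real) powr \<beta>"
  define p where "p = 4 * q"
  have q: "0 < q" "q < 1"
    using \<beta> powr_less_mono2[of \<beta> "1/4" 1] by (simp_all add: q_def)
  have "(1/4::real) powr 1 < (1/4) powr \<beta>"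
    using \<beta> by (intro powr_less_mono') auto
  then have p: "1 < p"
    by (simp add: p_def q_def)
  have qi: "(1 / 2 ^ i) powr (2 * \<beta>) = q ^ i" for i :: nat
  proof -
    have "q ^ i = ((1/4) ^ i) powr \<beta>"
    proof (induction i)
      case (Suc i)
      have "((1/4::real) ^ Suc i) powr \<beta> = (1/4) powr \<beta> * ((1/4) ^ i) powr \<beta>"
        unfolding power_Suc by (rule powr_mult)
      with Suc show ?case
        by (simp add: q_def)
    qed simp
    also have "(1/4::real) ^ i = (1 / 2 ^ i) * (1 / 2 ^ i)"
      by (simp add: power_divide flip: power_mult_distrib)
    also have "\<dots> powr \<beta> = (1 / 2 ^ i) powr (2 * \<beta>)"
      by (subst powr_mult) (simp_all flip: powr_add)
    finally show ?thesis
      by (rule sym)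
  qed
  have four: "(2 ^ i)\<^sup>2 = (4::real) ^ i" for i :: nat
    by (simp add: power2_eq_square flip: power_mult_distrib)
  define B where "B = 4 / (p - 1) + 1 / (1 - q)"
  have "B > 0"
    using p q by (simp add: B_def add_pos_pos)
  moreover have "(\<Sum>i\<le>n. dyadic_weight \<beta> H i) \<le> B * H powr (2 * \<beta>)" if H: "0 \<le> H" "H \<le> 1" for H n
  proof (cases "H = 0")
    case True
    then show ?thesis
      by (simp add: dyadic_weight_def)
  next
    case False
    with H have "0 < H"
      by simp
    then have "1 \<le> 1 / H"
      using H by simp
    then obtain m where m: "2 ^ m \<le> 1 / H" "1 / H < 2 ^ Suc m"
      by (rule dyadic_scale)
    have qm: "q ^ Suc m \<le> H powr (2 * \<beta>)"
    proof -
      have "1 / 2 ^ Suc m \<le> H"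
        using m(2) \<open>0 < H\<close> by (simp add: field_simps)
      then have "(1 / 2 ^ Suc m) powr (2 * \<beta>) \<le> H powr (2 * \<beta>)"
        using \<beta> by (intro powr_mono2) auto
      then show ?thesis
        by (simp only: qi)
    qed
    have Hm: "H\<^sup>2 * p ^ m \<le> q ^ m"
    proof -
      have "(H * 2 ^ m)\<^sup>2 \<le> 1\<^sup>2"
        using m(1) \<open>0 < H\<close> by (intro power_mono) (auto simp: field_simps)
      then have "H\<^sup>2 * 4 ^ m \<le> 1"
        by (simp add: power_mult_distrib four)
      then have "(H\<^sup>2 * 4 ^ m) * q ^ m \<le> 1 * q ^ m"
        using q by (intro mult_right_mono) auto
      then show ?thesis
        by (simp add: p_def power_mult_distrib mult_ac)
    qed
    have t1: "dyadic_weight \<beta> H i \<le> H\<^sup>2 * p ^ i" for i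
    proof -
      have "(min 1 (2 ^ i * H))\<^sup>2 \<le> (2 ^ i * H)\<^sup>2"
        using H by (intro power_mono) auto
      also have "\<dots> = H\<^sup>2 * 4 ^ i"
        by (simp add: power_mult_distrib four)
      finally have "(min 1 (2 ^ i * H))\<^sup>2 * q ^ i \<le> H\<^sup>2 * 4 ^ i * q ^ i"
        using q by (intro mult_right_mono) auto
      then show ?thesis
        unfolding dyadic_weight_def qi p_def by (simp add: power_mult_distrib mult_ac)
    qed
    have t2: "dyadic_weight \<beta> H i \<le> q ^ i" for i
    proof -
      have "(min 1 (2 ^ i * H))\<^sup>2 \<le> 1\<^sup>2"
        using H by (intro power_mono) auto
      then have "(min 1 (2 ^ i * H))\<^sup>2 * q ^ i \<le> 1 * q ^ i"
        using q by (intro mult_right_mono) auto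
      then show ?thesis
        unfolding dyadic_weight_def qi by simp
    qed
    \<comment> \<open>For n < m the union is larger than \<open>{..n}\<close>; the additional terms
      are nonnegative.\<close>
    have "(\<Sum>i\<le>n. dyadic_weight \<beta> H i) \<le> (\<Sum>i\<in>{0..m} \<union> {Suc m..n}. dyadic_weight \<beta> H i)"
      by (intro sum_mono2) (auto simp: dyadic_weight_nonneg)
    also have "\<dots> = (\<Sum>i=0..m. dyadic_weight \<beta> H i) + (\<Sum>i=Suc m..n. dyadic_weight \<beta> H i)"
      by (intro sum.union_disjoint) auto
    also have "\<dots> \<le> (\<Sum>i=0..m. H\<^sup>2 * p ^ i) + (\<Sum>i=Suc m..n. q ^ i)"
      by (intro add_mono sum_mono t1 t2)
    also have "(\<Sum>i=0..m. H\<^sup>2 * p ^ i) \<le> 4 / (p - 1) * H powr (2 * \<beta>)"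
    proof -
      have "(\<Sum>i=0..m. p ^ i) \<le> p * p ^ m / (p - 1)"
        using p by (simp add: sum_gp field_simps)
      then have "H\<^sup>2 * (\<Sum>i=0..m. p ^ i) \<le> H\<^sup>2 * (p * p ^ m / (p - 1))"
        by (rule mult_left_mono) simp
      also have "\<dots> = p / (p - 1) * (H\<^sup>2 * p ^ m)"
        by simp
      also have "\<dots> \<le> p / (p - 1) * q ^ m"
        using p by (intro mult_left_mono Hm) auto
      \<comment> \<open>The factor q inside p raises the exponent to \<open>Suc m\<close>, which is
        the power that \<open>qm\<close> bounds.\<close>
      also have "\<dots> = 4 / (p - 1) * q ^ Suc m"
        by (simp add: p_def)
      also have "\<dots> \<le> 4 / (p - 1) * H powr (2 * \<beta>)"
        using p by (intro mult_left_mono qm) auto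
      finally show ?thesis
        by (simp add: sum_distrib_left)
    qed
    also have "(\<Sum>i=Suc m..n. q ^ i) \<le> 1 / (1 - q) * H powr (2 * \<beta>)"
    proof -
      have "(\<Sum>i=Suc m..n. q ^ i) \<le> q ^ Suc m / (1 - q)"
        using q by (auto simp: sum_gp divide_right_mono)
      also have "\<dots> \<le> H powr (2 * \<beta>) / (1 - q)"
        using q by (intro divide_right_mono qm) auto
      finally show ?thesis
        by simp
    qed
    finally show ?thesis
      by (simp add: B_def distrib_right)
  qed
  ultimately show thesis
    using that by blast
qed

text \<open>The Lipschitz bound at step \<delta> / 2^i contributes 2^(-2 i \<alpha>), which merges
  with the decay 2^(-2 i \<gamma>) of the symbol into a weight of exponent \<alpha> + \<gamma>. This
  is the gain of smoothness, and the reason for \<alpha> + \<gamma> < 1.\<close>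

lemma dyadic_weight_sum_scaled:
  assumes \<gamma>: "0 < \<alpha>" "\<alpha> + \<gamma> < 1" "0 \<le> \<gamma>" and \<delta>: "0 < \<delta>"
  shows "\<exists>B>0. \<forall>H n. 0 \<le> H \<longrightarrow> H \<le> 1 \<longrightarrow>
      (\<Sum>i\<le>n. 16 / \<delta>\<^sup>2 * dyadic_weight \<gamma> H i * (\<delta> / 2 ^ i) powr (2 * \<alpha>)) \<le> B * H powr (2 * (\<alpha> + \<gamma>))"
proof -
  obtain B where B: "B > 0"
    "\<And>H n. 0 \<le> H \<Longrightarrow> H \<le> 1 \<Longrightarrow> (\<Sum>i\<le>n. dyadic_weight (\<alpha> + \<gamma>) H i) \<le> B * H powr (2 * (\<alpha> + \<gamma>))"
    using dyadic_weight_sum[of "\<alpha> + \<gamma>"] \<gamma> by (metis add_pos_nonneg)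
  let ?c = "16 / \<delta>\<^sup>2 * \<delta> powr (2 * \<alpha>)"
  have eq: "16 / \<delta>\<^sup>2 * dyadic_weight \<gamma> H i * (\<delta> / 2 ^ i) powr (2 * \<alpha>) = ?c * dyadic_weight (\<alpha> + \<gamma>) H i" for H i
  proof -
    have "(\<delta> / 2 ^ i) powr (2 * \<alpha>) = \<delta> powr (2 * \<alpha>) * (1 / 2 ^ i) powr (2 * \<alpha>)"
      using \<delta> by (simp add: powr_divide)
    moreover have "(1 / 2 ^ i :: real) powr (2 * (\<alpha> + \<gamma>)) = (1 / 2 ^ i) powr (2 * \<gamma>) * (1 / 2 ^ i) powr (2 * \<alpha>)"
      by (simp add: distrib_left add.commute flip: powr_add)
    ultimately show ?thesis
      by (simp add: dyadic_weight_def)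
  qed
  show ?thesis
  proof (intro exI conjI allI impI)
    show "?c * B > 0"
      using \<delta> B by simp
    fix H :: real and n assume "0 \<le> H" "H \<le> 1"
    then show "(\<Sum>i\<le>n. 16 / \<delta>\<^sup>2 * dyadic_weight \<gamma> H i * (\<delta> / 2 ^ i) powr (2 * \<alpha>)) \<le> ?c * B * H powr (2 * (\<alpha> + \<gamma>))"
      unfolding eq sum_distrib_left[symmetric] mult.assoc[of ?c]
      using B(2) \<delta> by (intro mult_left_mono) auto
  qed
qed

text \<open>
  Multiplying out the product over \<open>j\<close> turns the left-hand side into a positive combination of the
  instances of \<open>bound\<close> at the dyadic steps \<open>t\<^sub>j = \<delta> / 2\<^sup>i\<close>.
\<close>

lemma dyadic_transfer:
  fixes a :: "real^'n \<Rightarrow> real" and m :: "'n \<Rightarrow> real \<Rightarrow> real" and W :: "'n \<Rightarrow> nat \<Rightarrow> real" and \<alpha> :: "real^'n"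
  assumes F: "finite F" and a: "\<And>k. k \<in> F \<Longrightarrow> 0 \<le> a k" and \<delta>: "0 < \<delta>" and K: "0 \<le> K"
    and bound: "\<And>t :: real^'n. (\<And>j. \<bar>t $ j\<bar> \<le> \<delta>) \<Longrightarrow>
      (\<Sum>k\<in>F. a k * (\<Prod>j\<in>UNIV. diff_weight (k $ j * t $ j))) \<le> K * (\<Prod>j\<in>UNIV. \<bar>t $ j\<bar> powr (2 * \<alpha> $ j))"
    and m: "\<And>j u. 0 \<le> m j u" and W: "\<And>j i. 0 \<le> W j i"
    and dom: "\<And>j u. \<exists>i. m j u \<le> W j i * diff_weight (u * (\<delta> / 2 ^ i))"
    and sum: "\<And>j n. (\<Sum>i\<le>n. W j i * (\<delta> / 2 ^ i) powr (2 * \<alpha> $ j)) \<le> B j"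
  shows "(\<Sum>k\<in>F. a k * (\<Prod>j\<in>UNIV. m j (k $ j))) \<le> K * (\<Prod>j\<in>UNIV. B j)"
proof -
  obtain i where i: "\<And>j u. m j u \<le> W j (i j u) * diff_weight (u * (\<delta> / 2 ^ i j u))"
    using dom by metis
  \<comment> \<open>Only finitely many scales occur because F is finite; \<open>insert 0\<close>
    keeps \<open>Max\<close> meaningful when F is empty.\<close>
  define n where "n = Max (insert 0 ((\<lambda>(j, k). i j (k $ j)) ` (UNIV \<times> F)))"
  have n: "i j (k $ j) \<le> n" if "k \<in> F" for j k
    unfolding n_def using F that by (intro Max_ge) auto
  \<comment> \<open>Each g in this set chooses a scale for every coordinate independently, that is,
    one step vector for \<open>bound\<close>.\<close>
  let ?P = "PiE (UNIV :: 'n set) (\<lambda>_. {..n})"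
  let ?s = "\<lambda>g k. \<Prod>j\<in>UNIV. diff_weight (k $ j * (\<delta> / 2 ^ g j))"
  let ?w = "\<lambda>g. \<Prod>j\<in>UNIV. W j (g j)"
  have "(\<Prod>j\<in>UNIV. m j (k $ j)) \<le> (\<Sum>g\<in>?P. ?w g * ?s g k)" if "k \<in> F" for k
  proof -
    have "(\<Prod>j\<in>UNIV. m j (k $ j)) \<le> (\<Prod>j\<in>UNIV. \<Sum>i\<le>n. W j i * diff_weight (k $ j * (\<delta> / 2 ^ i)))"
    proof (intro prod_mono conjI m)
      fix j
      have "m j (k $ j) \<le> W j (i j (k $ j)) * diff_weight (k $ j * (\<delta> / 2 ^ i j (k $ j)))"
        by (rule i)
      also have "\<dots> \<le> (\<Sum>i\<le>n. W j i * diff_weight (k $ j * (\<delta> / 2 ^ i)))"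
        using n[OF that] W diff_weight_nonneg
        by (intro member_le_sum[where f = "\<lambda>i. W j i * diff_weight (k $ j * (\<delta> / 2 ^ i))"]) auto
      finally show "m j (k $ j) \<le> (\<Sum>i\<le>n. W j i * diff_weight (k $ j * (\<delta> / 2 ^ i)))" .
    qed
    also have "\<dots> = (\<Sum>g\<in>?P. \<Prod>j\<in>UNIV. W j (g j) * diff_weight (k $ j * (\<delta> / 2 ^ g j)))"
      by (rule prod_sum_PiE) auto
    finally show ?thesis
      by (simp add: prod.distrib)
  qed
  then have "(\<Sum>k\<in>F. a k * (\<Prod>j\<in>UNIV. m j (k $ j))) \<le> (\<Sum>k\<in>F. a k * (\<Sum>g\<in>?P. ?w g * ?s g k))"
    by (intro sum_mono mult_left_mono a)
  also have "\<dots> = (\<Sum>k\<in>F. \<Sum>g\<in>?P. ?w g * (a k * ?s g k))"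
    by (simp add: sum_distrib_left mult_ac)
  also have "\<dots> = (\<Sum>g\<in>?P. \<Sum>k\<in>F. ?w g * (a k * ?s g k))"
    by (rule sum.swap)
  also have "\<dots> = (\<Sum>g\<in>?P. ?w g * (\<Sum>k\<in>F. a k * ?s g k))"
    by (simp add: sum_distrib_left)
  also have "\<dots> \<le> (\<Sum>g\<in>?P. ?w g * (K * (\<Prod>j\<in>UNIV. (\<delta> / 2 ^ g j) powr (2 * \<alpha> $ j))))"
  proof (intro sum_mono mult_left_mono prod_nonneg)
    fix g :: "'n \<Rightarrow> nat"
    have "\<bar>(\<chi> j. \<delta> / 2 ^ g j) $ j\<bar> \<le> \<delta>" for j
    proof -
      have "\<delta> / 2 ^ g j \<le> \<delta> / 1"
        using \<delta> by (intro divide_left_mono) auto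
      then show ?thesis
        using \<delta> by simp
    qed
    from bound[OF this] show "(\<Sum>k\<in>F. a k * ?s g k) \<le> K * (\<Prod>j\<in>UNIV. (\<delta> / 2 ^ g j) powr (2 * \<alpha> $ j))"
      using \<delta> by simp
  qed (use W in auto)
  also have "\<dots> = K * (\<Sum>g\<in>?P. \<Prod>j\<in>UNIV. W j (g j) * (\<delta> / 2 ^ g j) powr (2 * \<alpha> $ j))"
    by (simp add: sum_distrib_left prod.distrib mult_ac)
  also have "(\<Sum>g\<in>?P. \<Prod>j\<in>UNIV. W j (g j) * (\<delta> / 2 ^ g j) powr (2 * \<alpha> $ j)) =
      (\<Prod>j\<in>UNIV. \<Sum>i\<le>n. W j i * (\<delta> / 2 ^ i) powr (2 * \<alpha> $ j))"
    by (rule prod_sum_PiE[symmetric]) auto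
  also have "K * \<dots> \<le> K * (\<Prod>j\<in>UNIV. B j)"
    using W by (intro mult_left_mono prod_mono conjI sum sum_nonneg K) auto
  finally show ?thesis .
qed

section \<open>Mixed differences and Fourier tails\<close>

lemma norm_character_axis: "(norm (character k (t *\<^sub>R axis j 1) - 1))\<^sup>2 = diff_weight (k $ j * t)"
  using norm_cis_minus_1[of "k $ j * t"] by (simp add: character_def inner_axis mult_ac)

context lattice_domain
begin

text \<open>The induction carries that each iterate is again periodic, of the form G composed with
  \<open>rep\<close>. The next difference therefore acts on the quotient, where
  \<open>coef_rep\<close> evaluates its coefficients.\<close>

lemma fold_partial_diff:
  assumes "finite S" and f: "f \<in> sq_integrable (lebesgue_on \<Omega>)"
  shows "\<exists>G\<in>sq_integrable (lebesgue_on \<Omega>).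
    Finite_Set.fold (\<lambda>j. partial_diff j (h $ j)) (\<lambda>x. f (rep x)) S = (\<lambda>x. G (rep x)) \<and>
    (\<forall>k\<in>dual_lattice A. coef G k = (\<Prod>j\<in>S. character k (h $ j *\<^sub>R axis j 1) - 1) * coef f k)"
  using \<open>finite S\<close>
proof (induction S)
  case empty
  then show ?case
    using f by auto
next
  case (insert j S)
  then obtain G where G: "G \<in> sq_integrable (lebesgue_on \<Omega>)"
    and fold: "Finite_Set.fold (\<lambda>j. partial_diff j (h $ j)) (\<lambda>x. f (rep x)) S = (\<lambda>x. G (rep x))"
    and coef: "\<And>k. k \<in> dual_lattice A \<Longrightarrow> coef G k = (\<Prod>j\<in>S. character k (h $ j *\<^sub>R axis j 1) - 1) * coef f k"
    by blast
  let ?t = "h $ j *\<^sub>R axis j 1"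
  interpret comp_fun_commute "\<lambda>j. partial_diff j (h $ j)"
    by (rule comp_fun_commute_partial_diff)
  \<comment> \<open>Writing \<open>x + 0\<close> makes the second term a translate too, so
    \<open>rep_rep_add\<close> and \<open>coef_rep\<close> treat both terms alike.\<close>
  define G' where "G' x = G (rep (x + ?t)) - G (rep (x + 0))" for x
  have "Finite_Set.fold (\<lambda>j. partial_diff j (h $ j)) (\<lambda>x. f (rep x)) (insert j S) =
      partial_diff j (h $ j) (\<lambda>x. G (rep x))"
    using insert.hyps by (simp add: fold)
  also have "\<dots> = (\<lambda>x. G' (rep x))"
    unfolding partial_diff_def G'_def rep_rep_add by simp
  finally have 1: "Finite_Set.fold (\<lambda>j. partial_diff j (h $ j)) (\<lambda>x. f (rep x)) (insert j S) = (\<lambda>x. G' (rep x))" .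
  have 2: "G' \<in> sq_integrable (lebesgue_on \<Omega>)"
    unfolding G'_def[abs_def] by (intro sq_integrable_diff sq_integrable_rep G)
  have 3: "coef G' k = (\<Prod>j\<in>insert j S. character k (h $ j *\<^sub>R axis j 1) - 1) * coef f k"
    if k: "k \<in> dual_lattice A" for k
  proof -
    have "coef G' k = character k ?t * coef G k - character k 0 * coef G k"
      unfolding G'_def[abs_def] using k by (simp only: coef_diff sq_integrable_rep G coef_rep)
    also have "character k 0 = 1"
      by (simp add: character_def)
    finally show ?thesis
      using insert.hyps coef[OF k] by (simp add: algebra_simps)
  qed
  show ?case
    using 1 2 3 by blast
qed

lemma energy_mixed_diff:
  assumes f: "f \<in> sq_integrable (lebesgue_on \<Omega>)"
  shows "((\<lambda>k. (norm (coef f k))\<^sup>2 * (\<Prod>j\<in>UNIV. diff_weight (k $ j * h $ j))) has_sum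
    energy (mixed_diff h (periodic_ext A \<Omega> f))) (dual_lattice A)"
proof -
  obtain G where G: "G \<in> sq_integrable (lebesgue_on \<Omega>)"
    and fold: "mixed_diff h (periodic_ext A \<Omega> f) = (\<lambda>x. G (rep x))"
    and coef: "\<And>k. k \<in> dual_lattice A \<Longrightarrow> coef G k = (\<Prod>j\<in>UNIV. character k (h $ j *\<^sub>R axis j 1) - 1) * coef f k"
    using fold_partial_diff[OF finite_class.finite_UNIV f, of h] unfolding mixed_diff_def periodic_ext_eq[abs_def] by blast
  have eq: "(norm (coef G k))\<^sup>2 = (norm (coef f k))\<^sup>2 * (\<Prod>j\<in>UNIV. diff_weight (k $ j * h $ j))"
    if "k \<in> dual_lattice A" for k
    by (simp add: coef[OF that] norm_mult power_mult_distrib prod_power_distrib norm_character_axis mult.commute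
        flip: prod_norm)
  \<comment> \<open>The energy only sees \<Omega>, where \<open>rep\<close> is the identity.\<close>
  have en: "energy (mixed_diff h (periodic_ext A \<Omega> f)) = energy G"
    unfolding energy_def fold
    by (intro arg_cong2[where f = "(*)"] refl Bochner_Integration.integral_cong) (simp add: space_restrict_space rep_Omega)
  have "((\<lambda>k. (norm (coef G k))\<^sup>2) has_sum energy G) (dual_lattice A)"
    unfolding parseval[OF G] using summable_coef[OF G] by (rule has_sum_infsum)
  then show ?thesis
    unfolding en by (rule has_sum_cong[THEN iffD1, rotated]) (rule eq)
qed

end

context lattice_domain
begin

text \<open>Turns the asymptotic condition into one cube of steps and one constant valid for all
  finite F, the form in which \<open>dyadic_transfer\<close> takes it.\<close>

lemma LipM_spectral_bound:
  assumes "f \<in> LipM A \<Omega> \<alpha>"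
  obtains \<delta> K where "0 < \<delta>" "\<delta> \<le> 1/8" "0 \<le> K"
    "\<And>F t. finite F \<Longrightarrow> F \<subseteq> dual_lattice A \<Longrightarrow> (\<And>j. \<bar>t $ j\<bar> \<le> \<delta>) \<Longrightarrow>
      (\<Sum>k\<in>F. (norm (coef f k))\<^sup>2 * (\<Prod>j\<in>UNIV. diff_weight (k $ j * t $ j))) \<le>
      K * (\<Prod>j\<in>UNIV. \<bar>t $ j\<bar> powr (2 * \<alpha> $ j))"
proof -
  have f: "f \<in> sq_integrable (lebesgue_on \<Omega>)"
    using assms by (simp add: LipM_def L2_space_eq)
  obtain K where K: "K > 0" "\<forall>\<^sub>F h in nhds 0.
     L2_norm_on \<Omega> (mixed_diff h (periodic_ext A \<Omega> f)) \<le> K * (\<Prod>j\<in>UNIV. \<bar>h $ j\<bar> powr (\<alpha> $ j))"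
    using assms by (auto simp: LipM_def)
  then obtain e where e: "e > 0" "\<And>h. dist h 0 < e \<Longrightarrow>
     L2_norm_on \<Omega> (mixed_diff h (periodic_ext A \<Omega> f)) \<le> K * (\<Prod>j\<in>UNIV. \<bar>h $ j\<bar> powr (\<alpha> $ j))"
    unfolding eventually_nhds_metric by blast
  \<comment> \<open>The cap 1/8 serves \<open>diff_weight_dyadic_ge\<close>. The other bound puts
    the cube of half-width \<delta> inside the ball of radius e, by the l1 norm; the factor 2 gives
    strictness.\<close>
  define \<delta> where "\<delta> = min (1/8) (e / (2 * real CARD('n)))"
  have card: "0 < real CARD('n)"
    by simp
  show thesis
  proof (rule that[of \<delta> "K\<^sup>2"])
    show "0 < \<delta>"
      using e(1) card by (simp add: \<delta>_def)
    show "\<delta> \<le> 1/8"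
      by (simp add: \<delta>_def)
    show "0 \<le> K\<^sup>2"
      by simp
    fix F and t :: "real^'n"
    assume F: "finite F" "F \<subseteq> dual_lattice A" and t: "\<And>j. \<bar>t $ j\<bar> \<le> \<delta>"
    have "norm t \<le> (\<Sum>j\<in>UNIV. \<bar>t $ j\<bar>)"
      by (rule norm_le_l1_cart)
    also have "\<dots> \<le> real CARD('n) * \<delta>"
      using sum_bounded_above[of UNIV "\<lambda>j. \<bar>t $ j\<bar>" \<delta>] t by simp
    also have "\<dots> \<le> real CARD('n) * (e / (2 * real CARD('n)))"
      by (intro mult_left_mono) (auto simp: \<delta>_def)
    also have "\<dots> < e"
      using e(1) card by simp
    finally have le: "L2_norm_on \<Omega> (mixed_diff t (periodic_ext A \<Omega> f)) \<le> K * (\<Prod>j\<in>UNIV. \<bar>t $ j\<bar> powr (\<alpha> $ j))"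
      by (intro e(2)) simp
    have hs: "((\<lambda>k. (norm (coef f k))\<^sup>2 * (\<Prod>j\<in>UNIV. diff_weight (k $ j * t $ j))) has_sum
        energy (mixed_diff t (periodic_ext A \<Omega> f))) (dual_lattice A)"
      using f by (rule energy_mixed_diff)
    have "(\<Sum>k\<in>F. (norm (coef f k))\<^sup>2 * (\<Prod>j\<in>UNIV. diff_weight (k $ j * t $ j))) \<le>
        energy (mixed_diff t (periodic_ext A \<Omega> f))"
      unfolding infsumI[OF hs, symmetric]
      by (intro finite_sum_le_infsum has_sum_imp_summable[OF hs] F) (auto intro!: mult_nonneg_nonneg prod_nonneg diff_weight_nonneg)
    also have "\<dots> = (L2_norm_on \<Omega> (mixed_diff t (periodic_ext A \<Omega> f)))\<^sup>2"
      by (simp add: L2_norm_eq energy_def)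
    also have "\<dots> \<le> (K * (\<Prod>j\<in>UNIV. \<bar>t $ j\<bar> powr (\<alpha> $ j)))\<^sup>2"
      using le by (rule power_mono) (simp add: L2_norm_eq energy_def)
    also have "\<dots> = K\<^sup>2 * (\<Prod>j\<in>UNIV. \<bar>t $ j\<bar> powr (2 * \<alpha> $ j))"
      by (simp add: power_mult_distrib powr_square prod_power_distrib)
    finally show "(\<Sum>k\<in>F. (norm (coef f k))\<^sup>2 * (\<Prod>j\<in>UNIV. diff_weight (k $ j * t $ j))) \<le>
        K\<^sup>2 * (\<Prod>j\<in>UNIV. \<bar>t $ j\<bar> powr (2 * \<alpha> $ j))" .
  qed
qed

lemma fourier_tail_sum:
  "fourier_tail A \<Omega> f N =
    sqrt (\<Sum>\<^sub>\<infinity>k\<in>{k \<in> dual_lattice A. \<forall>j. \<bar>k $ j\<bar> > real (N $ j)}. (norm (coef f k))\<^sup>2)"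
  by (simp add: fourier_tail_def fourier_coeff_eq)

lemma summable_coef_tail:
  "f \<in> sq_integrable (lebesgue_on \<Omega>) \<Longrightarrow>
    (\<lambda>k. (norm (coef f k))\<^sup>2) summable_on {k \<in> dual_lattice A. P k}"
  using summable_coef by (rule summable_on_subset_banach) auto

text \<open>The domination with \<gamma> = 0 and H the reciprocal of \<open>N $ j\<close> in
  coordinate j. It makes the source norm finite; M depends on f, since \<delta> and K do.\<close>

lemma fourier_tail_bounded:
  assumes f: "f \<in> LipM A \<Omega> \<alpha>" and \<alpha>: "\<And>j. 0 < \<alpha> $ j \<and> \<alpha> $ j < 1"
  obtains M where "0 \<le> M"
    "\<And>N. (\<Prod>j\<in>UNIV. real (N $ j) powr (\<alpha> $ j)) * fourier_tail A \<Omega> f N \<le> M"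
proof -
  have f': "f \<in> sq_integrable (lebesgue_on \<Omega>)"
    using f by (simp add: LipM_def L2_space_eq)
  obtain \<delta> K where \<delta>: "0 < \<delta>" "\<delta> \<le> 1/8" and K: "0 \<le> K"
    and bound: "\<And>F t. finite F \<Longrightarrow> F \<subseteq> dual_lattice A \<Longrightarrow> (\<And>j. \<bar>t $ j\<bar> \<le> \<delta>) \<Longrightarrow>
      (\<Sum>k\<in>F. (norm (coef f k))\<^sup>2 * (\<Prod>j\<in>UNIV. diff_weight (k $ j * t $ j))) \<le>
      K * (\<Prod>j\<in>UNIV. \<bar>t $ j\<bar> powr (2 * \<alpha> $ j))"
    using f by (rule LipM_spectral_bound) blast
  have "\<exists>B>0. \<forall>H n. 0 \<le> H \<longrightarrow> H \<le> 1 \<longrightarrow>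
      (\<Sum>i\<le>n. 16 / \<delta>\<^sup>2 * dyadic_weight 0 H i * (\<delta> / 2 ^ i) powr (2 * \<alpha> $ j)) \<le> B * H powr (2 * \<alpha> $ j)" for j
    using dyadic_weight_sum_scaled[of "\<alpha> $ j" 0 \<delta>] \<alpha>[of j] \<delta>(1) by simp
  then have "\<exists>B. \<forall>j. B j > 0 \<and> (\<forall>H n. 0 \<le> H \<longrightarrow> H \<le> 1 \<longrightarrow>
      (\<Sum>i\<le>n. 16 / \<delta>\<^sup>2 * dyadic_weight 0 H i * (\<delta> / 2 ^ i) powr (2 * \<alpha> $ j)) \<le> B j * H powr (2 * \<alpha> $ j))"
    by (intro choice allI)
  then obtain B where B: "\<And>j. B j > 0" "\<And>j H n. 0 \<le> H \<Longrightarrow> H \<le> 1 \<Longrightarrow>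
      (\<Sum>i\<le>n. 16 / \<delta>\<^sup>2 * dyadic_weight 0 H i * (\<delta> / 2 ^ i) powr (2 * \<alpha> $ j)) \<le> B j * H powr (2 * \<alpha> $ j)"
    by blast
  define M where "M = sqrt (K * (\<Prod>j\<in>UNIV. B j))"
  have M2: "M\<^sup>2 = K * (\<Prod>j\<in>UNIV. B j)"
    unfolding M_def using K B(1) by (intro real_sqrt_pow2 mult_nonneg_nonneg prod_nonneg) (auto simp: less_imp_le)
  have "0 \<le> M"
    using K B(1) by (simp add: M_def prod_nonneg less_imp_le)
  moreover have "(\<Prod>j\<in>UNIV. real (N $ j) powr (\<alpha> $ j)) * fourier_tail A \<Omega> f N \<le> M" for N
  \<comment> \<open>As \<open>0 powr a = 0\<close>, a zero entry of N kills the whole weight;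
    otherwise every entry is at least 1 and its reciprocal is admissible as H.\<close>
  proof (cases "\<exists>j. N $ j = 0")
    case True
    then have "(\<Prod>j\<in>UNIV. real (N $ j) powr (\<alpha> $ j)) = 0"
      by auto
    then show ?thesis
      using \<open>0 \<le> M\<close> by (simp only: mult_zero_left)
  next
    case False
    then have N: "1 \<le> real (N $ j)" for j
      by (simp add: Suc_leI)
    let ?T = "{k \<in> dual_lattice A. \<forall>j. \<bar>k $ j\<bar> > real (N $ j)}"
    have "(\<Sum>\<^sub>\<infinity>k\<in>?T. (norm (coef f k))\<^sup>2) \<le> K * (\<Prod>j\<in>UNIV. B j * (1 / real (N $ j)) powr (2 * \<alpha> $ j))"
    proof (rule infsum_le_finite_sums)
      show "(\<lambda>k. (norm (coef f k))\<^sup>2) summable_on ?T"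
        by (rule summable_coef_tail[OF f'])
      fix F assume F: "finite F" "F \<subseteq> ?T"
      have "(\<Sum>k\<in>F. (norm (coef f k))\<^sup>2) =
          (\<Sum>k\<in>F. (norm (coef f k))\<^sup>2 * (\<Prod>j\<in>UNIV. if \<bar>k $ j\<bar> > real (N $ j) then 1 else 0))"
        using F by (intro sum.cong) auto
      also have "\<dots> \<le> K * (\<Prod>j\<in>UNIV. B j * (1 / real (N $ j)) powr (2 * \<alpha> $ j))"
      proof (rule dyadic_transfer[where m = "\<lambda>j u. if \<bar>u\<bar> > real (N $ j) then 1 else 0"
            and W = "\<lambda>j i. 16 / \<delta>\<^sup>2 * dyadic_weight 0 (1 / real (N $ j)) i"])
        show "(\<Sum>k\<in>F. (norm (coef f k))\<^sup>2 * (\<Prod>j\<in>UNIV. diff_weight (k $ j * t $ j))) \<le>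
            K * (\<Prod>j\<in>UNIV. \<bar>t $ j\<bar> powr (2 * \<alpha> $ j))" if "\<And>j. \<bar>t $ j\<bar> \<le> \<delta>" for t :: "real^'n"
          using F that by (intro bound) auto
        show "\<exists>i. (if \<bar>u\<bar> > real (N $ j) then 1 else 0) \<le>
            16 / \<delta>\<^sup>2 * dyadic_weight 0 (1 / real (N $ j)) i * diff_weight (u * (\<delta> / 2 ^ i))" for j u
          by (rule indicator_dominated[OF \<delta> N])
        show "(\<Sum>i\<le>n. 16 / \<delta>\<^sup>2 * dyadic_weight 0 (1 / real (N $ j)) i * (\<delta> / 2 ^ i) powr (2 * \<alpha> $ j))
            \<le> B j * (1 / real (N $ j)) powr (2 * \<alpha> $ j)" for j n
          using N[of j] by (intro B(2)) auto
      qed (use F \<delta> K dyadic_weight_nonneg in auto)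
      finally show "(\<Sum>k\<in>F. (norm (coef f k))\<^sup>2) \<le> K * (\<Prod>j\<in>UNIV. B j * (1 / real (N $ j)) powr (2 * \<alpha> $ j))" .
    qed
    also have "\<dots> = (M * (\<Prod>j\<in>UNIV. (1 / real (N $ j)) powr (\<alpha> $ j)))\<^sup>2"
      by (simp add: M2 power_mult_distrib prod.distrib powr_square prod_power_distrib)
    finally have "fourier_tail A \<Omega> f N \<le> sqrt ((M * (\<Prod>j\<in>UNIV. (1 / real (N $ j)) powr (\<alpha> $ j)))\<^sup>2)"
      unfolding fourier_tail_sum by (rule real_sqrt_le_mono)
    also have "\<dots> = M * (\<Prod>j\<in>UNIV. (1 / real (N $ j)) powr (\<alpha> $ j))"
      using \<open>0 \<le> M\<close> by (simp add: prod_nonneg)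
    finally have "(\<Prod>j\<in>UNIV. real (N $ j) powr (\<alpha> $ j)) * fourier_tail A \<Omega> f N \<le>
        (\<Prod>j\<in>UNIV. real (N $ j) powr (\<alpha> $ j)) * (M * (\<Prod>j\<in>UNIV. (1 / real (N $ j)) powr (\<alpha> $ j)))"
      by (rule mult_left_mono) (simp add: prod_nonneg)
    also have "\<dots> = M * (\<Prod>j\<in>UNIV. real (N $ j) powr (\<alpha> $ j) * (1 / real (N $ j)) powr (\<alpha> $ j))"
      by (simp add: prod.distrib)
    also have "(\<Prod>j\<in>UNIV. real (N $ j) powr (\<alpha> $ j) * (1 / real (N $ j)) powr (\<alpha> $ j)) = 1"
    proof (intro prod.neutral ballI)
      fix j
      show "real (N $ j) powr (\<alpha> $ j) * (1 / real (N $ j)) powr (\<alpha> $ j) = 1"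
        using N[of j] by (simp add: powr_divide)
    qed
    finally show ?thesis
      by simp
  qed
  ultimately show thesis
    using that by blast
qed

lemma LipM_norm_finite:
  assumes f: "f \<in> LipM A \<Omega> \<alpha>" and \<alpha>: "\<And>j. 0 < \<alpha> $ j \<and> \<alpha> $ j < 1"
  shows "LipM_norm A \<Omega> \<alpha> f < top"
proof -
  obtain M where "\<And>N. (\<Prod>j\<in>UNIV. real (N $ j) powr (\<alpha> $ j)) * fourier_tail A \<Omega> f N \<le> M"
    using fourier_tail_bounded[OF f \<alpha>] by blast
  then have "(SUP N. ennreal ((\<Prod>j\<in>UNIV. real (N $ j) powr (\<alpha> $ j)) * fourier_tail A \<Omega> f N)) \<le> ennreal M"
    by (intro SUP_least ennreal_leI)
  then have "(SUP N. ennreal ((\<Prod>j\<in>UNIV. real (N $ j) powr (\<alpha> $ j)) * fourier_tail A \<Omega> f N)) < top"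
    by (rule le_less_trans) simp
  then show ?thesis
    by (simp add: LipM_norm_def)
qed

end

section \<open>Multipliers with a decaying symbol\<close>

locale lattice_symbol = lattice_domain A \<Omega> for A :: "real^'n^'n" and \<Omega> +
  fixes \<gamma> :: "real^'n" and \<sigma> :: "real^'n \<Rightarrow> complex" and C :: real
  assumes \<gamma>: "\<And>j. 0 \<le> \<gamma> $ j" and C: "0 < C"
    and \<sigma>: "\<And>k. k \<in> dual_lattice A \<Longrightarrow>
      norm (\<sigma> k) \<le> C * (\<Prod>j\<in>UNIV. japanese_bracket (k $ j) powr (- (\<gamma> $ j)))"
begin

lemma symbol_le: "k \<in> dual_lattice A \<Longrightarrow> norm (\<sigma> k) \<le> C"
proof -
  assume k: "k \<in> dual_lattice A"
  have "(\<Prod>j\<in>UNIV. japanese_bracket (k $ j) powr (- (\<gamma> $ j))) \<le> (\<Prod>j\<in>(UNIV::'n set). 1)"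
    using powr_minus_antimono[OF _ japanese_bracket_ge(1) \<gamma>] by (intro prod_mono) simp
  then have "C * (\<Prod>j\<in>UNIV. japanese_bracket (k $ j) powr (- (\<gamma> $ j))) \<le> C * 1"
    using C by (intro mult_left_mono) auto
  with \<sigma>[OF k] show ?thesis
    by simp
qed

lemma norm_symbol_coef_le:
  "k \<in> dual_lattice A \<Longrightarrow> (norm (\<sigma> k * c))\<^sup>2 \<le> C\<^sup>2 * (norm c)\<^sup>2"
  using symbol_le[of k] by (simp add: norm_mult power_mult_distrib mult_right_mono power_mono)

text \<open>The symbol is bounded by C, so the multiplied coefficients stay square summable and
  Riesz-Fischer supplies a representative for each f.\<close>

lemma fourier_multiplier_exists: "\<exists>T. fourier_multiplier A \<Omega> \<sigma> T"
proof -
  have "\<exists>g\<in>sq_integrable (lebesgue_on \<Omega>). \<forall>k\<in>dual_lattice A. coef g k = \<sigma> k * coef f k"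
    if f: "f \<in> sq_integrable (lebesgue_on \<Omega>)" for f
  proof -
    have "(\<lambda>k. (norm (\<sigma> k * coef f k))\<^sup>2) summable_on dual_lattice A"
    proof (rule summable_on_comparison_test)
      show "(\<lambda>k. C\<^sup>2 * (norm (coef f k))\<^sup>2) summable_on dual_lattice A"
        by (intro summable_on_cmult_right summable_coef f)
    qed (auto intro: norm_symbol_coef_le)
    then obtain g where "g \<in> sq_integrable (lebesgue_on \<Omega>)" "\<And>k. k \<in> dual_lattice A \<Longrightarrow> coef g k = \<sigma> k * coef f k"
      by (rule riesz_fischer) blast
    then show ?thesis
      by blast
  qed
  then have "\<exists>T. \<forall>f\<in>sq_integrable (lebesgue_on \<Omega>). T f \<in> sq_integrable (lebesgue_on \<Omega>) \<and>
      (\<forall>k\<in>dual_lattice A. coef (T f) k = \<sigma> k * coef f k)"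
    by (metis (no_types))
  then show ?thesis
    by (simp add: fourier_multiplier_def L2_space_eq fourier_coeff_eq)
qed

section \<open>Estimates for a single image g of f under the multiplier\<close>

context
  fixes f g :: "real^'n \<Rightarrow> complex"
  assumes f: "f \<in> sq_integrable (lebesgue_on \<Omega>)" and g: "g \<in> sq_integrable (lebesgue_on \<Omega>)"
    and coef_g: "\<And>k. k \<in> dual_lattice A \<Longrightarrow> coef g k = \<sigma> k * coef f k"
begin

lemma L2_norm_image: "L2_norm_on \<Omega> g \<le> C * L2_norm_on \<Omega> f"
proof -
  have "energy g \<le> (\<Sum>\<^sub>\<infinity>k\<in>dual_lattice A. C\<^sup>2 * (norm (coef f k))\<^sup>2)"
    unfolding parseval[OF g]
    by (intro infsum_mono summable_coef g summable_on_cmult_right f) (simp add: coef_g norm_symbol_coef_le)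
  also have "\<dots> = C\<^sup>2 * energy f"
    unfolding parseval[OF f] by (rule infsum_cmult_right')
  finally have "sqrt (energy g) \<le> sqrt (C\<^sup>2 * energy f)"
    by (rule real_sqrt_le_mono)
  then show ?thesis
    using C by (simp add: L2_norm_eq real_sqrt_mult)
qed

text \<open>Beyond N each bracket is at least \<open>N $ j\<close>, so the product bound on the
  symbol becomes a constant on the tail.\<close>

lemma fourier_tail_image:
  assumes N: "\<And>j. 1 \<le> N $ j"
  shows "fourier_tail A \<Omega> g N \<le> C * (\<Prod>j\<in>UNIV. real (N $ j) powr (- (\<gamma> $ j))) * fourier_tail A \<Omega> f N"
proof -
  let ?T = "{k \<in> dual_lattice A. \<forall>j. \<bar>k $ j\<bar> > real (N $ j)}"
  let ?D = "C * (\<Prod>j\<in>UNIV. real (N $ j) powr (- (\<gamma> $ j)))"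
  have D: "0 \<le> ?D"
    using C by (simp add: prod_nonneg)
  have "(norm (coef g k))\<^sup>2 \<le> ?D\<^sup>2 * (norm (coef f k))\<^sup>2" if k: "k \<in> ?T" for k
  proof -
    have "real (N $ j) \<le> japanese_bracket (k $ j)" for j
    proof -
      have "real (N $ j) < \<bar>k $ j\<bar>"
        using k by blast
      then show ?thesis
        using japanese_bracket_ge(2)[of "k $ j"] by linarith
    qed
    then have "japanese_bracket (k $ j) powr (- (\<gamma> $ j)) \<le> real (N $ j) powr (- (\<gamma> $ j))" for j
      using N[of j] \<gamma>[of j] by (intro powr_minus_antimono) auto
    then have "(\<Prod>j\<in>UNIV. japanese_bracket (k $ j) powr (- (\<gamma> $ j))) \<le> (\<Prod>j\<in>UNIV. real (N $ j) powr (- (\<gamma> $ j)))"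
      by (intro prod_mono) simp
    then have "C * (\<Prod>j\<in>UNIV. japanese_bracket (k $ j) powr (- (\<gamma> $ j))) \<le> ?D"
      using C by (intro mult_left_mono) auto
    then have "norm (\<sigma> k) \<le> ?D"
      using \<sigma>[of k] k by auto
    then have "(norm (\<sigma> k))\<^sup>2 \<le> ?D\<^sup>2"
      by (rule power_mono) simp
    then have "(norm (\<sigma> k))\<^sup>2 * (norm (coef f k))\<^sup>2 \<le> ?D\<^sup>2 * (norm (coef f k))\<^sup>2"
      by (rule mult_right_mono) simp
    then show ?thesis
      using k coef_g by (simp add: norm_mult power_mult_distrib)
  qed
  then have "(\<Sum>\<^sub>\<infinity>k\<in>?T. (norm (coef g k))\<^sup>2) \<le> (\<Sum>\<^sub>\<infinity>k\<in>?T. ?D\<^sup>2 * (norm (coef f k))\<^sup>2)"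
    by (intro infsum_mono summable_coef_tail g summable_on_cmult_right f)
  also have "\<dots> = ?D\<^sup>2 * (\<Sum>\<^sub>\<infinity>k\<in>?T. (norm (coef f k))\<^sup>2)"
    by (rule infsum_cmult_right')
  finally have "fourier_tail A \<Omega> g N \<le> sqrt (?D\<^sup>2 * (\<Sum>\<^sub>\<infinity>k\<in>?T. (norm (coef f k))\<^sup>2))"
    unfolding fourier_tail_sum by (rule real_sqrt_le_mono)
  also have "\<dots> = ?D * fourier_tail A \<Omega> f N"
    using D by (simp only: real_sqrt_mult real_sqrt_abs abs_of_nonneg fourier_tail_sum)
  finally show ?thesis .
qed

text \<open>The decay of the symbol on a tail cancels exactly the extra weight of exponent \<gamma>,
  which leaves the constant C, uniform in f.\<close>

lemma LipM_norm_image: "LipM_norm A \<Omega> (\<alpha> + \<gamma>) g \<le> ennreal C * LipM_norm A \<Omega> \<alpha> f"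
proof -
  have "ennreal ((\<Prod>j\<in>UNIV. real (N $ j) powr ((\<alpha> + \<gamma>) $ j)) * fourier_tail A \<Omega> g N) \<le>
      ennreal C * ennreal ((\<Prod>j\<in>UNIV. real (N $ j) powr (\<alpha> $ j)) * fourier_tail A \<Omega> f N)" for N
  proof (cases "\<exists>j. N $ j = 0")
    case True
    then have "(\<Prod>j\<in>UNIV. real (N $ j) powr ((\<alpha> + \<gamma>) $ j)) = 0"
      by auto
    then show ?thesis
      by (simp only: mult_zero_left ennreal_0 zero_le)
  next
    case False
    then have N: "1 \<le> N $ j" for j
      by (simp add: Suc_leI)
    have "(\<Prod>j\<in>UNIV. real (N $ j) powr ((\<alpha> + \<gamma>) $ j)) * fourier_tail A \<Omega> g N \<le>
        (\<Prod>j\<in>UNIV. real (N $ j) powr ((\<alpha> + \<gamma>) $ j)) *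
        (C * (\<Prod>j\<in>UNIV. real (N $ j) powr (- (\<gamma> $ j))) * fourier_tail A \<Omega> f N)"
      by (intro mult_left_mono fourier_tail_image N prod_nonneg) simp
    also have "\<dots> = C * ((\<Prod>j\<in>UNIV. real (N $ j) powr ((\<alpha> + \<gamma>) $ j) * real (N $ j) powr (- (\<gamma> $ j))) * fourier_tail A \<Omega> f N)"
      by (simp add: prod.distrib)
    also have "(\<Prod>j\<in>UNIV. real (N $ j) powr ((\<alpha> + \<gamma>) $ j) * real (N $ j) powr (- (\<gamma> $ j))) =
        (\<Prod>j\<in>UNIV. real (N $ j) powr (\<alpha> $ j))"
      by (simp flip: powr_add)
    finally show ?thesis
      using C by (simp add: ennreal_leI flip: ennreal_mult')
  qed
  then have "(SUP N. ennreal ((\<Prod>j\<in>UNIV. real (N $ j) powr ((\<alpha> + \<gamma>) $ j)) * fourier_tail A \<Omega> g N)) \<le>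
      (SUP N. ennreal C * ennreal ((\<Prod>j\<in>UNIV. real (N $ j) powr (\<alpha> $ j)) * fourier_tail A \<Omega> f N))"
    by (intro SUP_mono) blast
  also have "\<dots> = ennreal C * (SUP N. ennreal ((\<Prod>j\<in>UNIV. real (N $ j) powr (\<alpha> $ j)) * fourier_tail A \<Omega> f N))"
    by (rule SUP_mult_left_ennreal[symmetric])
  moreover have "ennreal (L2_norm_on \<Omega> g) \<le> ennreal C * ennreal (L2_norm_on \<Omega> f)"
    using L2_norm_image C by (simp add: ennreal_leI flip: ennreal_mult')
  ultimately show ?thesis
    unfolding LipM_norm_def distrib_left by (intro add_mono) auto
qed

text \<open>Differences of g with steps \<open>h $ j\<close> are compared with differences of f at
  the steps \<delta> / 2^i, none of which exceeds \<delta>. So the estimate for g holds for all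
  steps up to 1, although f is controlled only near 0.\<close>

lemma LipM_image:
  assumes fL: "f \<in> LipM A \<Omega> \<alpha>" and \<alpha>: "\<And>j. 0 < \<alpha> $ j \<and> \<alpha> $ j < 1 - \<gamma> $ j"
  shows "g \<in> LipM A \<Omega> (\<alpha> + \<gamma>)"
proof -
  obtain \<delta> K where \<delta>: "0 < \<delta>" "\<delta> \<le> 1/8" and K: "0 \<le> K"
    and bound: "\<And>F t. finite F \<Longrightarrow> F \<subseteq> dual_lattice A \<Longrightarrow> (\<And>j. \<bar>t $ j\<bar> \<le> \<delta>) \<Longrightarrow>
      (\<Sum>k\<in>F. (norm (coef f k))\<^sup>2 * (\<Prod>j\<in>UNIV. diff_weight (k $ j * t $ j))) \<le>
      K * (\<Prod>j\<in>UNIV. \<bar>t $ j\<bar> powr (2 * \<alpha> $ j))"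
    using fL by (rule LipM_spectral_bound) blast
  have "\<exists>B>0. \<forall>H n. 0 \<le> H \<longrightarrow> H \<le> 1 \<longrightarrow>
      (\<Sum>i\<le>n. 16 / \<delta>\<^sup>2 * dyadic_weight (\<gamma> $ j) H i * (\<delta> / 2 ^ i) powr (2 * \<alpha> $ j)) \<le>
      B * H powr (2 * (\<alpha> + \<gamma>) $ j)" for j
  proof -
    have "\<alpha> $ j + \<gamma> $ j < 1"
      using \<alpha>[of j] by simp
    then show ?thesis
      using dyadic_weight_sum_scaled[of "\<alpha> $ j" "\<gamma> $ j" \<delta>] \<alpha>[of j] \<gamma>[of j] \<delta>(1) by simp
  qed
  then have "\<exists>B. \<forall>j. B j > 0 \<and> (\<forall>H n. 0 \<le> H \<longrightarrow> H \<le> 1 \<longrightarrow>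
      (\<Sum>i\<le>n. 16 / \<delta>\<^sup>2 * dyadic_weight (\<gamma> $ j) H i * (\<delta> / 2 ^ i) powr (2 * \<alpha> $ j)) \<le>
      B j * H powr (2 * (\<alpha> + \<gamma>) $ j))"
    by (intro choice allI)
  then obtain B where B: "\<And>j. B j > 0" "\<And>j H n. 0 \<le> H \<Longrightarrow> H \<le> 1 \<Longrightarrow>
      (\<Sum>i\<le>n. 16 / \<delta>\<^sup>2 * dyadic_weight (\<gamma> $ j) H i * (\<delta> / 2 ^ i) powr (2 * \<alpha> $ j)) \<le>
      B j * H powr (2 * (\<alpha> + \<gamma>) $ j)"
    by blast
  define M where "M = sqrt (C\<^sup>2 * K * (\<Prod>j\<in>UNIV. B j))"
  have M2: "M\<^sup>2 = C\<^sup>2 * K * (\<Prod>j\<in>UNIV. B j)"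
    unfolding M_def using K B(1) by (intro real_sqrt_pow2 mult_nonneg_nonneg prod_nonneg) (auto simp: less_imp_le)
  have M: "0 \<le> M"
    using K B(1) by (simp add: M_def prod_nonneg less_imp_le)
  have est: "L2_norm_on \<Omega> (mixed_diff h (periodic_ext A \<Omega> g)) \<le> M * (\<Prod>j\<in>UNIV. \<bar>h $ j\<bar> powr ((\<alpha> + \<gamma>) $ j))"
    if h: "\<And>j. \<bar>h $ j\<bar> \<le> 1" for h
  proof -
    let ?R = "C\<^sup>2 * (K * (\<Prod>j\<in>UNIV. B j * \<bar>h $ j\<bar> powr (2 * (\<alpha> + \<gamma>) $ j)))"
    have hs: "((\<lambda>k. (norm (coef g k))\<^sup>2 * (\<Prod>j\<in>UNIV. diff_weight (k $ j * h $ j))) has_sum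
        energy (mixed_diff h (periodic_ext A \<Omega> g))) (dual_lattice A)"
      using g by (rule energy_mixed_diff)
    have "(\<Sum>\<^sub>\<infinity>k\<in>dual_lattice A. (norm (coef g k))\<^sup>2 * (\<Prod>j\<in>UNIV. diff_weight (k $ j * h $ j))) \<le> ?R"
    proof (rule infsum_le_finite_sums[OF has_sum_imp_summable[OF hs]])
      fix F assume F: "finite F" "F \<subseteq> dual_lattice A"
      let ?m = "\<lambda>j u. diff_weight (u * h $ j) * (japanese_bracket u powr (- (\<gamma> $ j)))\<^sup>2"
      have "(norm (coef g k))\<^sup>2 * (\<Prod>j\<in>UNIV. diff_weight (k $ j * h $ j)) \<le>
          C\<^sup>2 * ((norm (coef f k))\<^sup>2 * (\<Prod>j\<in>UNIV. ?m j (k $ j)))" if "k \<in> F" for k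
      proof -
        have k: "k \<in> dual_lattice A"
          using F that by blast
        have "(norm (\<sigma> k))\<^sup>2 \<le> (C * (\<Prod>j\<in>UNIV. japanese_bracket (k $ j) powr (- (\<gamma> $ j))))\<^sup>2"
          by (rule power_mono[OF \<sigma>[OF k]]) simp
        then have "(norm (\<sigma> k))\<^sup>2 * ((norm (coef f k))\<^sup>2 * (\<Prod>j\<in>UNIV. diff_weight (k $ j * h $ j))) \<le>
            (C * (\<Prod>j\<in>UNIV. japanese_bracket (k $ j) powr (- (\<gamma> $ j))))\<^sup>2 *
              ((norm (coef f k))\<^sup>2 * (\<Prod>j\<in>UNIV. diff_weight (k $ j * h $ j)))"
          by (rule mult_right_mono) (auto intro!: mult_nonneg_nonneg prod_nonneg diff_weight_nonneg)
        then show ?thesis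
          by (simp add: coef_g[OF k] norm_mult power_mult_distrib prod.distrib prod_power_distrib mult_ac)
      qed
      then have "(\<Sum>k\<in>F. (norm (coef g k))\<^sup>2 * (\<Prod>j\<in>UNIV. diff_weight (k $ j * h $ j))) \<le>
          (\<Sum>k\<in>F. C\<^sup>2 * ((norm (coef f k))\<^sup>2 * (\<Prod>j\<in>UNIV. ?m j (k $ j))))"
        by (rule sum_mono)
      also have "\<dots> = C\<^sup>2 * (\<Sum>k\<in>F. (norm (coef f k))\<^sup>2 * (\<Prod>j\<in>UNIV. ?m j (k $ j)))"
        by (rule sum_distrib_left[symmetric])
      also have "\<dots> \<le> ?R"
      proof (intro mult_left_mono dyadic_transfer[where m = ?m
            and W = "\<lambda>j i. 16 / \<delta>\<^sup>2 * dyadic_weight (\<gamma> $ j) \<bar>h $ j\<bar> i"])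
        show "(\<Sum>k\<in>F. (norm (coef f k))\<^sup>2 * (\<Prod>j\<in>UNIV. diff_weight (k $ j * t $ j))) \<le>
            K * (\<Prod>j\<in>UNIV. \<bar>t $ j\<bar> powr (2 * \<alpha> $ j))" if "\<And>j. \<bar>t $ j\<bar> \<le> \<delta>" for t :: "real^'n"
          using F that by (intro bound) auto
        show "\<exists>i. ?m j u \<le> 16 / \<delta>\<^sup>2 * dyadic_weight (\<gamma> $ j) \<bar>h $ j\<bar> i * diff_weight (u * (\<delta> / 2 ^ i))" for j u
          by (rule symbol_dominated[OF \<delta> \<gamma> h])
        show "(\<Sum>i\<le>n. 16 / \<delta>\<^sup>2 * dyadic_weight (\<gamma> $ j) \<bar>h $ j\<bar> i * (\<delta> / 2 ^ i) powr (2 * \<alpha> $ j))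
            \<le> B j * \<bar>h $ j\<bar> powr (2 * (\<alpha> + \<gamma>) $ j)" for j n
          using h[of j] by (intro B(2)) auto
      qed (use F \<delta> K dyadic_weight_nonneg diff_weight_nonneg in auto)
      finally show "(\<Sum>k\<in>F. (norm (coef g k))\<^sup>2 * (\<Prod>j\<in>UNIV. diff_weight (k $ j * h $ j))) \<le> ?R" .
    qed
    then have "energy (mixed_diff h (periodic_ext A \<Omega> g)) \<le> ?R"
      by (simp only: infsumI[OF hs])
    also have "?R = (M * (\<Prod>j\<in>UNIV. \<bar>h $ j\<bar> powr ((\<alpha> + \<gamma>) $ j)))\<^sup>2"
      by (simp add: M2 power_mult_distrib prod.distrib powr_square prod_power_distrib)
    finally have "L2_norm_on \<Omega> (mixed_diff h (periodic_ext A \<Omega> g)) \<le>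
        sqrt ((M * (\<Prod>j\<in>UNIV. \<bar>h $ j\<bar> powr ((\<alpha> + \<gamma>) $ j)))\<^sup>2)"
      unfolding L2_norm_eq by (rule real_sqrt_le_mono)
    then show ?thesis
      using M by (simp add: prod_nonneg)
  qed
  \<comment> \<open>\<open>LipM\<close> demands a positive constant, while M is only known to be
    nonnegative.\<close>
  have "L2_norm_on \<Omega> (mixed_diff h (periodic_ext A \<Omega> g)) \<le> (M + 1) * (\<Prod>j\<in>UNIV. \<bar>h $ j\<bar> powr ((\<alpha> + \<gamma>) $ j))"
    if "dist h 0 < 1" for h
  proof -
    have "\<bar>h $ j\<bar> \<le> 1" for j
      using component_le_norm_cart[of h j] that by simp
    then have "L2_norm_on \<Omega> (mixed_diff h (periodic_ext A \<Omega> g)) \<le> M * (\<Prod>j\<in>UNIV. \<bar>h $ j\<bar> powr ((\<alpha> + \<gamma>) $ j))"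
      by (rule est)
    also have "\<dots> \<le> (M + 1) * (\<Prod>j\<in>UNIV. \<bar>h $ j\<bar> powr ((\<alpha> + \<gamma>) $ j))"
      by (intro mult_right_mono prod_nonneg) auto
    finally show ?thesis .
  qed
  then have "\<forall>\<^sub>F h in nhds 0. L2_norm_on \<Omega> (mixed_diff h (periodic_ext A \<Omega> g)) \<le>
      (M + 1) * (\<Prod>j\<in>UNIV. \<bar>h $ j\<bar> powr ((\<alpha> + \<gamma>) $ j))"
    unfolding eventually_nhds_metric by (intro exI[of _ 1]) simp
  then have "\<exists>K>0. \<forall>\<^sub>F h in nhds 0. L2_norm_on \<Omega> (mixed_diff h (periodic_ext A \<Omega> g)) \<le>
      K * (\<Prod>j\<in>UNIV. \<bar>h $ j\<bar> powr ((\<alpha> + \<gamma>) $ j))"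
    using M by (intro exI[of _ "M + 1"]) simp
  then show ?thesis
    using g by (simp add: LipM_def L2_space_eq)
qed

end

text \<open>Linearity is derived from the symbol: both sides have the same coefficients, and
  completeness makes them equal almost everywhere.\<close>

lemma bounded_LipM_multiplier:
  assumes T: "fourier_multiplier A \<Omega> \<sigma> T" and \<alpha>: "\<And>j. 0 < \<alpha> $ j \<and> \<alpha> $ j < 1 - \<gamma> $ j"
  shows "bounded_LipM_operator A \<Omega> \<alpha> (\<alpha> + \<gamma>) T"
proof -
  have TL: "T f \<in> sq_integrable (lebesgue_on \<Omega>)"
    and coef_T: "\<And>k. k \<in> dual_lattice A \<Longrightarrow> coef (T f) k = \<sigma> k * coef f k"
    if "f \<in> sq_integrable (lebesgue_on \<Omega>)" for f
    using T that by (auto simp: fourier_multiplier_def L2_space_eq fourier_coeff_eq)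
  have L2: "f \<in> LipM A \<Omega> \<alpha> \<Longrightarrow> f \<in> sq_integrable (lebesgue_on \<Omega>)" for f
    by (simp add: LipM_def L2_space_eq)
  have \<alpha>1: "0 < \<alpha> $ j \<and> \<alpha> $ j < 1" for j
    using \<alpha>[of j] \<gamma>[of j] by simp
  show ?thesis
    unfolding bounded_LipM_operator_def
  proof (intro conjI ballI allI)
    fix f g assume "f \<in> LipM A \<Omega> \<alpha>" "g \<in> LipM A \<Omega> \<alpha>"
    then have fg: "f \<in> sq_integrable (lebesgue_on \<Omega>)" "g \<in> sq_integrable (lebesgue_on \<Omega>)"
      using L2 by auto
    show "AE x in lebesgue_on \<Omega>. T (\<lambda>y. f y + g y) x = T f x + T g x"
      using fg
      by (intro coef_unique TL sq_integrable_add) (simp_all add: coef_T coef_add sq_integrable_add TL distrib_left)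
  next
    fix f c assume "f \<in> LipM A \<Omega> \<alpha>"
    then have f: "f \<in> sq_integrable (lebesgue_on \<Omega>)"
      using L2 by auto
    show "AE x in lebesgue_on \<Omega>. T (\<lambda>y. c * f y) x = c * T f x"
      using f
      by (intro coef_unique TL sq_integrable_cmult) (simp_all add: coef_T coef_cmult sq_integrable_cmult)
  next
    fix f assume f: "f \<in> LipM A \<Omega> \<alpha>"
    show "T f \<in> LipM A \<Omega> (\<alpha> + \<gamma>)"
      using L2[OF f] TL coef_T f \<alpha> by (intro LipM_image) auto
    show "LipM_norm A \<Omega> \<alpha> f < top"
      using f \<alpha>1 by (rule LipM_norm_finite)
  next
    have "LipM_norm A \<Omega> (\<alpha> + \<gamma>) (T f) \<le> ennreal C * LipM_norm A \<Omega> \<alpha> f" if "f \<in> LipM A \<Omega> \<alpha>" for f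
      using L2[OF that] TL coef_T by (intro LipM_norm_image) auto
    then show "\<exists>M::real. \<forall>f \<in> LipM A \<Omega> \<alpha>. LipM_norm A \<Omega> (\<alpha> + \<gamma>) (T f) \<le> ennreal M * LipM_norm A \<Omega> \<alpha> f"
      by blast
  qed
qed

end

text \<open>The existence clause keeps the second clause from being vacuous; that clause speaks of
  every T because the symbol fixes T f only up to null sets.\<close>

theorem theorem4p9:
  fixes A :: "real^'n^'n" and \<Omega> :: "(real^'n) set"
    and \<gamma> :: "real^'n" and \<sigma> :: "real^'n \<Rightarrow> complex" and C :: real
  assumes "invertible A"
    and "fundamental_domain A \<Omega>"
    and "\<forall>j. 0 \<le> \<gamma> $ j \<and> \<gamma> $ j < 1"
    and "C > 0"
    and "\<forall>\<kappa> \<in> dual_lattice A.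
           norm (\<sigma> \<kappa>) \<le> C * (\<Prod>j\<in>UNIV. japanese_bracket (\<kappa> $ j) powr (- (\<gamma> $ j)))"
  shows "(\<exists>T. fourier_multiplier A \<Omega> \<sigma> T) \<and>
         (\<forall>T. fourier_multiplier A \<Omega> \<sigma> T \<longrightarrow>
            (\<forall>\<alpha>. (\<forall>j. 0 < \<alpha> $ j \<and> \<alpha> $ j < 1 - \<gamma> $ j) \<longrightarrow>
               bounded_LipM_operator A \<Omega> \<alpha> (\<alpha> + \<gamma>) T))"
proof -
  interpret lattice_symbol A \<Omega> \<gamma> \<sigma> C
    using assms by unfold_locales auto
  show ?thesis
    using fourier_multiplier_exists bounded_LipM_multiplier by blast
qed

end
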